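(* Suppose that $f:\mathbb{R}^d\to\mathbb{R}$ is convex and twice continuously differentiable with a minimizer $x^*$, that the symmetric Hessian approximation satisfies $\|H(x)-\nabla^2 f(x)\|\le\delta$ for all $x$, and that $f$ satisfies either the global or the local generalized Hessian smoothness condition (with constants $M_0,M_1\ge 0$, and radius $\rho>0$ in the local case). Let $R=\|x_0-x^*\|$, $r_0=\min\{\rho/2,1/(6\sqrt{M_1})\}$, $$B=\max\{1,(6\sqrt{M_1}R)^{2/3},(2R/\rho)^{2/3}\},\qquad\overline\tau_0=\max\{4\delta,\,2\sqrt{L(x_0)\|\nabla f(x_0)\|},\,2\|\nabla f(x_0)\|/\rho\},$$ $$\overline g=\max\{\|\nabla f(x)\|:\ \|x-x^*\|\le(1+2/\sqrt3)R\}.$$ Fix $\varepsilon>0$. Let $N$ be the number of outer iterations of the adaptive damped A-NPE method (started from $x_0$ with $\eta_0>0$), including initialization, until $A_N\ge R^2/(2\varepsilon)$ or an earlier zero-gradient return. Then the method uses at most $N$ Hessian evaluations and at most $$7N+\log_{2,+}\frac{\overline\tau_0}{\eta_0}+30\sqrt{\frac{2\delta R^2}\varepsilon}+120\Big(\frac{2M_0R^3}\varepsilon\Big)^{2/7}+8B\,\log_{2,+}\frac{\delta+\overline g/r_0}{\delta+M_0r_0}\left(1+\log_+\frac{4\max\{\eta_0,\overline\tau_0\}R^2}\varepsilon\right)^{2/3}$$ gradient evaluations.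
   Context: $\|\cdot\|$ is the Euclidean norm for vectors and the induced operator norm for matrices; $\log_+t=\max\{0,\log t\}$ and $\log_{2,+}t=\max\{0,\log_2t\}$ (equal to $0$ at $t=0$). Conventions: $a/(+\infty)=0$ for finite $a\ge0$, $a/0=+\infty$ for $a>0$, $1/\sqrt{M_1}=+\infty$ if $M_1=0$; if $r_0=+\infty$ the last term of the gradient bound is absent. Put $L(x)=M_0+M_1\|\nabla f(x)\|$. Global generalized Hessian smoothness: $\|\nabla^2f(y)-\nabla^2f(x)\|\le L(x)\|y-x\|$ for all $x,y\in\mathbb{R}^d$; in this case set $\rho=+\infty$. Local generalized Hessian smoothness with radius $\rho>0$: the same inequality for all $x,y$ with $\|y-x\|\le\rho$. Procedure $\mathrm{MSBacktrack}(x,\tau)$ (for $x\in\mathbb{R}^d$, $\tau>0$): repeat the following trial. If $H(x)+\tau I\succ0$, solve $(H(x)+\tau I)s=-\nabla f(x)$; if moreover $\|\nabla f(x+s)+\tau s\|\le\frac{\tau}{2}\|s\|$, return the pair $(x+s,\tau)$. Otherwise (trial rejected) replace $\tau$ by $2\tau$. Each call uses one evaluation of $H$ (at $x$), one gradient $\nabla f(x)$, and one gradient for each trial with $H(x)+\tau I\succ0$; the gradient at the accepted point is reused in the updates. Adaptive damped A-NPE method. Input $x_0\in\mathbb{R}^d$, $\eta_0>0$. Set $(w_1,\eta_1)=\mathrm{MSBacktrack}(x_0,\eta_0)$, $A_1=1/\eta_1$, $z_1=x_0-A_1\nabla f(w_1)$. For $k\ge1$: $a_k'=\frac{1+\sqrt{1+4\eta_kA_k}}{2\eta_k}$,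 $A_k'=A_k+a_k'$, $v_k=\frac{A_kw_k+a_k'z_k}{A_k'}$; $(y_k,\tau_k)=\mathrm{MSBacktrack}(v_k,\eta_k)$; $\gamma_k=\eta_k/\tau_k$, $a_{k+1}=\gamma_ka_k'$, $A_{k+1}=A_k+a_{k+1}$; $w_{k+1}=\frac{(1-\gamma_k)A_kw_k+\gamma_kA_k'y_k}{A_{k+1}}$, $z_{k+1}=z_k-a_{k+1}\nabla f(y_k)$; $\eta_{k+1}=\eta_k/2$ if $\tau_k=\eta_k$, and $\eta_{k+1}=2\eta_k$ otherwise. Whenever a queried gradient is zero, the method returns the corresponding point, which is a minimizer (a zero-gradient return). *)

theory Defs
  imports "HOL-Analysis.Analysis"
begin

definition gradient :: "(real^'d \<Rightarrow> real) \<Rightarrow> real^'d \<Rightarrow> real^'d" where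
  "gradient f x = (THE D. GDERIV f x :> D)"

definition hessian :: "(real^'d \<Rightarrow> real) \<Rightarrow> real^'d \<Rightarrow> real^'d^'d" where
  "hessian f x = matrix (frechet_derivative (gradient f) (at x))"

definition twice_continuously_differentiable :: "(real^'d \<Rightarrow> real) \<Rightarrow> bool" where
  "twice_continuously_differentiable f \<longleftrightarrow>
     (\<forall>x. f differentiable (at x)) \<and> (\<forall>x. gradient f differentiable (at x)) \<and>
     continuous_on UNIV (hessian f)"

definition op_norm :: "real^'d^'d \<Rightarrow> real" where
  "op_norm A = onorm (\<lambda>v. A *v v)"

text \<open>Only applied to symmetric matrices.\<close>
definition pos_def :: "real^'d^'d \<Rightarrow> bool" where
  "pos_def A \<longleftrightarrow> (\<forall>v. v \<noteq> 0 \<longrightarrow> v \<bullet> (A *v v) > 0)"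

definition local_lipschitz_const :: "(real^'d \<Rightarrow> real) \<Rightarrow> real \<Rightarrow> real \<Rightarrow> real^'d \<Rightarrow> real" where
  "local_lipschitz_const f M0 M1 x = M0 + M1 * norm (gradient f x)"

definition global_hessian_smooth :: "(real^'d \<Rightarrow> real) \<Rightarrow> real \<Rightarrow> real \<Rightarrow> bool" where
  "global_hessian_smooth f M0 M1 \<longleftrightarrow>
     (\<forall>x y. op_norm (hessian f y - hessian f x)
              \<le> local_lipschitz_const f M0 M1 x * norm (y - x))"

definition local_hessian_smooth :: "(real^'d \<Rightarrow> real) \<Rightarrow> real \<Rightarrow> real \<Rightarrow> real \<Rightarrow> bool" where
  "local_hessian_smooth f M0 M1 rad \<longleftrightarrow>
     (\<forall>x y. norm (y - x) \<le> rad \<longrightarrow>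
        op_norm (hessian f y - hessian f x)
          \<le> local_lipschitz_const f M0 M1 x * norm (y - x))"

definition log_plus :: "real \<Rightarrow> real" where
  "log_plus t = (if t \<le> 0 then 0 else max 0 (ln t))"

definition log2_plus :: "ereal \<Rightarrow> ereal" where
  "log2_plus t =
     (if t \<le> 0 then 0 else if t = \<infinity> then \<infinity> else ereal (max 0 (log 2 (real_of_ereal t))))"

text \<open>An execution either produces the accepted pair or ends the whole method at a point
  whose queried gradient vanishes.\<close>
datatype 'v ms_outcome = Accepted 'v real | ZeroGradient 'v

text \<open>The linear system has a unique solution whenever this is used, as the matrix is then
  positive definite; \<open>mat \<tau>\<close> is \<open>\<tau>\<close> times the identity.\<close>
definition ms_step ::
  "(real^'d \<Rightarrow> real) \<Rightarrow> (real^'d \<Rightarrow> real^'d^'d) \<Rightarrow> real^'d \<Rightarrow> real \<Rightarrow> real^'d" where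
  "ms_step f H x \<tau> = (THE s. (H x + mat \<tau>) *v s = - gradient f x)"

text \<open>\<open>ms_trials f H x \<tau> r n\<close>: the trial loop at \<open>x\<close>, entered with parameter \<open>\<tau>\<close>, terminates with
  outcome \<open>r\<close> after \<open>n\<close> gradient evaluations at trial points.  A loop that never terminates is
  related to no outcome.\<close>
inductive ms_trials ::
  "(real^'d \<Rightarrow> real) \<Rightarrow> (real^'d \<Rightarrow> real^'d^'d) \<Rightarrow> real^'d \<Rightarrow> real
     \<Rightarrow> (real^'d) ms_outcome \<Rightarrow> nat \<Rightarrow> bool" for f H x where
  not_pos_def:
    "\<lbrakk> \<not> pos_def (H x + mat \<tau>); ms_trials f H x (2 * \<tau>) r n \<rbrakk> \<Longrightarrow> ms_trials f H x \<tau> r n"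
| zero_gradient:
    "\<lbrakk> pos_def (H x + mat \<tau>); s = ms_step f H x \<tau>; gradient f (x + s) = 0 \<rbrakk>
     \<Longrightarrow> ms_trials f H x \<tau> (ZeroGradient (x + s)) 1"
| accepted:
    "\<lbrakk> pos_def (H x + mat \<tau>); s = ms_step f H x \<tau>; gradient f (x + s) \<noteq> 0;
       norm (gradient f (x + s) + \<tau> *\<^sub>R s) \<le> \<tau> / 2 * norm s \<rbrakk>
     \<Longrightarrow> ms_trials f H x \<tau> (Accepted (x + s) \<tau>) 1"
| rejected:
    "\<lbrakk> pos_def (H x + mat \<tau>); s = ms_step f H x \<tau>; gradient f (x + s) \<noteq> 0;
       \<not> norm (gradient f (x + s) + \<tau> *\<^sub>R s) \<le> \<tau> / 2 * norm s;
       ms_trials f H x (2 * \<tau>) r n \<rbrakk>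
     \<Longrightarrow> ms_trials f H x \<tau> r (Suc n)"

text \<open>\<open>ms_backtrack f H x \<tau> r h n\<close>: a full call, with \<open>h\<close> evaluations of \<open>H\<close> and \<open>n\<close> gradient
  evaluations.  The evaluation of \<open>H\<close> is charged even if the gradient at \<open>x\<close> vanishes.\<close>
inductive ms_backtrack ::
  "(real^'d \<Rightarrow> real) \<Rightarrow> (real^'d \<Rightarrow> real^'d^'d) \<Rightarrow> real^'d \<Rightarrow> real
     \<Rightarrow> (real^'d) ms_outcome \<Rightarrow> nat \<Rightarrow> nat \<Rightarrow> bool" for f H x \<tau> where
  stationary: "gradient f x = 0 \<Longrightarrow> ms_backtrack f H x \<tau> (ZeroGradient x) 1 1"
| trials: "\<lbrakk> gradient f x \<noteq> 0; ms_trials f H x \<tau> r n \<rbrakk> \<Longrightarrow> ms_backtrack f H x \<tau> r 1 (Suc n)"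

definition npe_a :: "real \<Rightarrow> real \<Rightarrow> real" where
  "npe_a \<eta> A = (1 + sqrt (1 + 4 * \<eta> * A)) / (2 * \<eta>)"

definition npe_v :: "real \<Rightarrow> real \<Rightarrow> real^'d \<Rightarrow> real^'d \<Rightarrow> real^'d" where
  "npe_v \<eta> A w z = (A *\<^sub>R w + npe_a \<eta> A *\<^sub>R z) /\<^sub>R (A + npe_a \<eta> A)"

text \<open>\<open>npe_loop f H x0 \<eta>0 T k w z A \<eta> h n\<close>: the method run with target \<open>T\<close> completes \<open>k\<close> outer
  iterations (the initialization being the first) without a zero-gradient return, with
  \<open>w, z, A, \<eta>\<close> the values of \<open>w\<^sub>k, z\<^sub>k, A\<^sub>k, \<eta>\<^sub>k\<close>, and has used \<open>h\<close> Hessian and \<open>n\<close> gradient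
  evaluations so far.  No further iteration is started once \<open>A \<ge> T\<close>.\<close>
inductive npe_loop ::
  "(real^'d \<Rightarrow> real) \<Rightarrow> (real^'d \<Rightarrow> real^'d^'d) \<Rightarrow> real^'d \<Rightarrow> real \<Rightarrow> real
     \<Rightarrow> nat \<Rightarrow> real^'d \<Rightarrow> real^'d \<Rightarrow> real \<Rightarrow> real \<Rightarrow> nat \<Rightarrow> nat \<Rightarrow> bool"
  for f H x0 \<eta>0 T where
  init:
    "\<lbrakk> ms_backtrack f H x0 \<eta>0 (Accepted w \<eta>) h n; A = 1 / \<eta>; z = x0 - A *\<^sub>R gradient f w \<rbrakk>
     \<Longrightarrow> npe_loop f H x0 \<eta>0 T 1 w z A \<eta> h n"
| step:
    "\<lbrakk> npe_loop f H x0 \<eta>0 T k w z A \<eta> h n; A < T;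
       ms_backtrack f H (npe_v \<eta> A w z) \<eta> (Accepted y \<tau>) h' n';
       a' = npe_a \<eta> A; A' = A + a';
       \<gamma> = \<eta> / \<tau>; a_next = \<gamma> * a'; A_next = A + a_next;
       w_next = (((1 - \<gamma>) * A) *\<^sub>R w + (\<gamma> * A') *\<^sub>R y) /\<^sub>R A_next;
       z_next = z - a_next *\<^sub>R gradient f y;
       \<eta>_next = (if \<tau> = \<eta> then \<eta> / 2 else 2 * \<eta>) \<rbrakk>
     \<Longrightarrow> npe_loop f H x0 \<eta>0 T (Suc k) w_next z_next A_next \<eta>_next (h + h') (n + n')"

text \<open>\<open>npe_halts f H x0 \<eta>0 T N h n\<close>: the method stops in outer iteration \<open>N\<close>, either because
  \<open>A\<^sub>N \<ge> T\<close> or by a zero-gradient return during that iteration, after \<open>h\<close> Hessian and \<open>n\<close>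
  gradient evaluations in total.\<close>
inductive npe_halts ::
  "(real^'d \<Rightarrow> real) \<Rightarrow> (real^'d \<Rightarrow> real^'d^'d) \<Rightarrow> real^'d \<Rightarrow> real \<Rightarrow> real
     \<Rightarrow> nat \<Rightarrow> nat \<Rightarrow> nat \<Rightarrow> bool"
  for f H x0 \<eta>0 T where
  target_reached:
    "\<lbrakk> npe_loop f H x0 \<eta>0 T k w z A \<eta> h n; A \<ge> T \<rbrakk> \<Longrightarrow> npe_halts f H x0 \<eta>0 T k h n"
| zero_return_init:
    "ms_backtrack f H x0 \<eta>0 (ZeroGradient p) h n \<Longrightarrow> npe_halts f H x0 \<eta>0 T 1 h n"
| zero_return_step:
    "\<lbrakk> npe_loop f H x0 \<eta>0 T k w z A \<eta> h n; A < T;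
       ms_backtrack f H (npe_v \<eta> A w z) \<eta> (ZeroGradient p) h' n' \<rbrakk>
     \<Longrightarrow> npe_halts f H x0 \<eta>0 T (Suc k) (h + h') (n + n')"

end

theory Submission
  imports Defs
begin

text \<open>
  Put \<open>T = R\<^sup>2 / (2\<epsilon>)\<close>. A call of the backtracking procedure that doubles its parameter \<open>j\<close>
  times costs at most \<open>j + 2\<close> gradients, so everything is about bounding \<open>\<Sum> j\<close>, where
  \<open>2\<^sup>j = \<tau> / \<eta>\<close>.

  \<^bold>\<open>Why a trial fails.\<close> If the trial with \<open>\<tau>/2\<close> fails, then \<open>\<tau>\<close> is of order \<open>\<delta>\<close>, or of order
  \<open>M0 q\<close> for a length \<open>q\<close> comparable to the accepted displacement, or \<open>q\<close> exceeds \<open>r0\<close>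
  (\<open>tau_excess_accepted\<close>). The smoothness inequality is applied with its constant taken at the
  \<^emph>\<open>end point\<close> of the trial step, where the gradient equals \<open>-\<tau> s\<close> up to the residual; this is
  what makes the \<open>M1\<close>-part of the constant harmless as long as the step is shorter than
  \<open>2 r0\<close>.

  \<^bold>\<open>Energy.\<close> \<open>A (f w - f xs) + |z - xs|\<^sup>2 / 2\<close> decreases by at least \<open>3/8 A' \<eta> |y - v|\<^sup>2\<close> in
  every iteration (\<open>tracked_step\<close>); the damping factor \<open>\<gamma> = \<eta>/\<tau>\<close> is exactly what replaces \<open>\<tau>\<close>
  by \<open>\<eta>\<close> here. Hence \<open>\<Sum> A' \<eta> |y - v|\<^sup>2 \<le> 4/3 R\<^sup>2\<close>, and all points at which the Hessian is
  queried stay in the ball that defines \<open>gbar\<close>.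

  \<^bold>\<open>Matching.\<close> Call an iteration an up-step if it doubles \<open>\<eta>\<close> and a down-step if it halves
  \<open>\<eta>\<close>. A down-step is undamped and adds \<open>1/(2 \<surd>\<eta>)\<close> to \<open>\<surd>A\<close>. Up-steps at a given level of \<open>\<eta>\<close>
  are paid for by the down-steps that brought \<open>\<eta>\<close> to that level, except for one up-step at
  each level from the initial one upwards; the latter form a geometric sum, which the start
  value \<open>A = 1/\<eta>\<close> covers. So \<open>D\<close>, the sum of \<open>\<eta>\<^sup>-\<^sup>1\<^sup>/\<^sup>2\<close> over the up-steps, satisfies
  \<open>D \<le> 7/2 \<surd>A\<close> at every moment.

  \<^bold>\<open>Summation.\<close> Write \<open>j = log 2 (\<tau>/\<eta>)\<close> and use \<open>log x \<lesssim> x\<^sup>p\<close>. If \<open>\<tau>\<close> is of order \<open>\<delta>\<close>, take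
  \<open>p = 1/2\<close>; the sum is \<open>\<surd>\<delta> D\<close>, giving \<open>\<surd>(\<delta> T)\<close>. If \<open>\<tau>\<close> is of order \<open>M0 q\<close>, take \<open>p = 2/7\<close>;
  Hoelder's inequality between the energy budget and the growth of \<open>D\<close> gives \<open>(M0 R T)\<^sup>2\<^sup>/\<^sup>7\<close>.
  If \<open>q > r0\<close>, factor \<open>\<tau>/\<eta> = (\<tau>/(\<delta> + M0 r0)) ((\<delta> + M0 r0)/\<eta>)\<close>: the second factor is covered by
  the previous two cases because \<open>r0 < q\<close>, the logarithm of the first is at most \<open>5/2\<close> plus
  the positive part of that of \<open>(\<delta> + gbar/r0)/(\<delta> + M0 r0)\<close>, and Hoelder's inequality bounds
  the number of such iterations by a multiple of \<open>(R/r0)\<^sup>2\<^sup>/\<^sup>3 (1 + log \<dots>)\<^sup>2\<^sup>/\<^sup>3\<close>. The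
  additive constants are absorbed by the term \<open>7 N\<close>.

  All these sums are carried along the run as real numbers attached to its states (\<open>ledger\<close>,
  \<open>loop_invariant\<close>). A final iteration that ends in a zero gradient contributes no energy;
  there the distance to the minimizer \<open>xs\<close> serves as \<open>q\<close> (\<open>tau_excess_distance\<close>).
\<close>

section \<open>Matrices and derivatives\<close>

lemma norm_matrix_vector_le:
  fixes A :: "real^'d^'d"
  shows "norm (A *v v) \<le> op_norm A * norm v"
  unfolding op_norm_def by (rule onorm[OF matrix_vector_mul_bounded_linear])

lemma mat_mult_vector:
  fixes v :: "real^'d"
  shows "mat \<tau> *v v = \<tau> *\<^sub>R v"
proof -
  have "mat \<tau> = \<tau> *\<^sub>R (mat 1 :: real^'d^'d)"
    by (simp add: mat_def vec_eq_iff)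
  then show ?thesis
    by (simp add: scaleR_matrix_vector_assoc[symmetric])
qed

text \<open>
  A positive definite matrix has trivial kernel, so it is injective and, in finite dimension,
  bijective. This justifies the definite description in the trial step.
\<close>

lemma pos_def_unique_solution:
  fixes A :: "real^'d^'d"
  assumes "pos_def A"
  shows "\<exists>!s. A *v s = b"
proof -
  have "u = 0" if "A *v u = 0" for u
    using assms that unfolding pos_def_def by (metis inner_zero_right less_irrefl)
  then have inj: "inj ((*v) A)"
    by (subst linear_injective_0) auto
  then have "surj ((*v) A)"
    by (intro linear_injective_imp_surjective) auto
  then show ?thesis
    using inj by (metis injD surjE)
qed

lemma ms_step_solves:
  assumes "pos_def (H x + mat \<tau>)"
  shows "H x *v ms_step f H x \<tau> + \<tau> *\<^sub>R ms_step f H x \<tau> = - gradient f x"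
proof -
  have "(H x + mat \<tau>) *v ms_step f H x \<tau> = - gradient f x"
    unfolding ms_step_def by (rule theI'[OF pos_def_unique_solution[OF assms]])
  then show ?thesis
    by (simp add: matrix_vector_mult_add_rdistrib mat_mult_vector)
qed

text \<open>
  The gradient is given by a definite description, so it is meaningful only once a
  representing vector exists and is unique; the adjoint of the derivative, applied to 1,
  provides it.
\<close>

lemma gradient_has_derivative:
  assumes "f differentiable (at x)"
  shows "(f has_derivative (\<lambda>h. h \<bullet> gradient f x)) (at x)"
proof -
  obtain f' where f': "(f has_derivative f') (at x)"
    using assms unfolding differentiable_def by blast
  then have lin: "linear f'" by (rule has_derivative_linear)
  have "f' h = h \<bullet> adjoint f' 1" for h
    using adjoint_works[OF lin, of h 1] by simp
  then have "f' = (\<lambda>h. h \<bullet> adjoint f' 1)" by auto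
  with f' have G: "GDERIV f x :> adjoint f' 1"
    unfolding gderiv_def by simp
  have "D = adjoint f' 1" if "GDERIV f x :> D" for D
  proof -
    have "(\<lambda>h. h \<bullet> D) = (\<lambda>h. h \<bullet> adjoint f' 1)"
      using that G unfolding gderiv_def by (rule has_derivative_unique)
    then show ?thesis by (metis vector_eq_ldot)
  qed
  then have "GDERIV f x :> gradient f x"
    unfolding gradient_def by (metis G theI')
  then show ?thesis unfolding gderiv_def .
qed

lemma hessian_has_derivative:
  assumes "gradient f differentiable (at x)"
  shows "(gradient f has_derivative (\<lambda>v. hessian f x *v v)) (at x)"
proof -
  let ?D = "frechet_derivative (gradient f) (at x)"
  have D: "(gradient f has_derivative ?D) (at x)"
    using assms by (simp add: frechet_derivative_works)
  then have "linear ?D" by (rule has_derivative_linear)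
  then have "(\<lambda>v. hessian f x *v v) = ?D"
    unfolding hessian_def by (auto simp: matrix_works linear_matrix_vector_mul_eq)
  then show ?thesis using D by simp
qed

lemma gradient_along_line:
  assumes "\<forall>x. gradient f differentiable (at x)"
  shows "((\<lambda>t. gradient f (x + t *\<^sub>R s)) has_vector_derivative hessian f (x + t *\<^sub>R s) *v s) (at t)"
proof -
  have "((\<lambda>t. gradient f (x + t *\<^sub>R s)) has_derivative (\<lambda>h. hessian f (x + t *\<^sub>R s) *v (h *\<^sub>R s))) (at t)"
    by (rule has_derivative_compose[OF _ hessian_has_derivative, of "\<lambda>t. x + t *\<^sub>R s"])
      (auto intro!: derivative_eq_intros assms[rule_format])
  then show ?thesis
    unfolding has_vector_derivative_def by (simp add: matrix_vector_mult_scaleR)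
qed

text \<open>
  The one-dimensional tangent inequality, applied to \<open>f\<close> along the line from \<open>x\<close> to \<open>y\<close>.
\<close>

lemma convex_above_tangent:
  assumes "convex_on UNIV f" "f differentiable (at x)"
  shows "f y \<ge> f x + gradient f x \<bullet> (y - x)"
proof -
  let ?\<phi> = "\<lambda>t::real. f (x + t *\<^sub>R (y - x))"
  have cvx: "convex_on UNIV ?\<phi>"
  proof (rule convex_onI)
    fix t a b :: real assume "0 < t" "t < 1"
    have "x + ((1 - t) *\<^sub>R a + t *\<^sub>R b) *\<^sub>R (y - x)
        = (1 - t) *\<^sub>R (x + a *\<^sub>R (y - x)) + t *\<^sub>R (x + b *\<^sub>R (y - x))"
      by (simp add: algebra_simps)
    then show "?\<phi> ((1 - t) *\<^sub>R a + t *\<^sub>R b) \<le> (1 - t) * ?\<phi> a + t * ?\<phi> b"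
      using convex_onD[OF assms(1), of t "x + a *\<^sub>R (y - x)" "x + b *\<^sub>R (y - x)"] \<open>0 < t\<close> \<open>t < 1\<close>
      by simp
  qed simp
  have "(?\<phi> has_derivative (\<lambda>h. (h *\<^sub>R (y - x)) \<bullet> gradient f x)) (at 0)"
    by (rule has_derivative_compose[of "\<lambda>t. x + t *\<^sub>R (y - x)" _ _ _ f])
      (auto intro!: derivative_eq_intros gradient_has_derivative assms(2))
  then have "(?\<phi> has_real_derivative gradient f x \<bullet> (y - x)) (at 0)"
    unfolding has_field_derivative_def
    by (rule has_derivative_eq_rhs) (auto simp: inner_commute mult.commute)
  from convex_on_imp_above_tangent[OF cvx, of 0 1, OF _ _ _ this]
  show ?thesis by simp
qed

section \<open>Convex functions with generalized Hessian smoothness\<close>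

locale convex_hessian_smooth =
  fixes f :: "real^'d \<Rightarrow> real" and H :: "real^'d \<Rightarrow> real^'d^'d"
    and xs :: "real^'d" and \<delta> M0 M1 :: real and \<rho> :: ereal
  assumes convex: "convex_on UNIV f"
    and twice_differentiable: "twice_continuously_differentiable f"
    and minimizer: "f xs \<le> f x"
    and hessian_approx: "op_norm (H x - hessian f x) \<le> \<delta>"
    and M0_nonneg: "M0 \<ge> 0" and M1_nonneg: "M1 \<ge> 0"
    and radius_pos: "\<rho> > 0"
    and hessian_lipschitz: "ereal (norm (y - x)) \<le> \<rho> \<Longrightarrow>
      op_norm (hessian f y - hessian f x) \<le> local_lipschitz_const f M0 M1 x * norm (y - x)"
begin

abbreviation "grad \<equiv> gradient f"
abbreviation "hess \<equiv> hessian f"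
abbreviation "L \<equiv> local_lipschitz_const f M0 M1"

lemma f_differentiable: "f differentiable (at x)"
  and gradient_differentiable: "grad differentiable (at x)"
  using twice_differentiable unfolding twice_continuously_differentiable_def by auto

lemma gradient_continuous: "continuous_on S grad"
  by (meson continuous_at_imp_continuous_on differentiable_imp_continuous_within gradient_differentiable)

lemma delta_nonneg: "\<delta> \<ge> 0"
proof -
  have "0 \<le> op_norm (H 0 - hessian f 0)"
    unfolding op_norm_def by (rule onorm_pos_le) simp
  then show ?thesis using hessian_approx[of 0] by simp
qed

lemma L_nonneg: "L x \<ge> 0"
  unfolding local_lipschitz_const_def using M0_nonneg M1_nonneg by simp

lemma above_tangent: "f y \<ge> f x + grad x \<bullet> (y - x)"
  by (rule convex_above_tangent[OF convex f_differentiable])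

lemma gradient_at_minimizer: "grad xs = 0"
proof -
  have "(\<lambda>h. h \<bullet> grad xs) = (\<lambda>h. 0)"
    by (rule differential_zero_maxmin[OF UNIV_I open_UNIV gradient_has_derivative[OF f_differentiable]])
      (simp add: minimizer)
  then show ?thesis by (metis inner_eq_zero_iff)
qed

lemma gradient_monotone: "(grad y - grad x) \<bullet> (y - x) \<ge> 0"
  using above_tangent[of x y] above_tangent[of y x] by (simp add: algebra_simps)

text \<open>
  The gradient of a convex function is monotone along every line, so its directional
  derivative there cannot be negative.
\<close>

lemma hessian_psd: "v \<bullet> (hess x *v v) \<ge> 0"
proof -
  have "((\<lambda>t. grad (x + t *\<^sub>R v)) has_vector_derivative hess (x + 0 *\<^sub>R v) *v v) (at 0)"
    by (rule gradient_along_line) (simp add: gradient_differentiable)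
  then have "((\<lambda>t. v \<bullet> grad (x + t *\<^sub>R v)) has_vector_derivative v \<bullet> (hess x *v v)) (at 0)"
    by (intro bounded_linear.has_vector_derivative[OF bounded_linear_inner_right]) simp
  then have D: "((\<lambda>t. v \<bullet> grad (x + t *\<^sub>R v)) has_real_derivative v \<bullet> (hess x *v v)) (at 0)"
    by (simp add: has_real_derivative_iff_has_vector_derivative)
  have mono: "v \<bullet> grad (x + s *\<^sub>R v) \<le> v \<bullet> grad (x + t *\<^sub>R v)" if "s < t" for s t
  proof -
    have "0 \<le> (grad (x + t *\<^sub>R v) - grad (x + s *\<^sub>R v)) \<bullet> ((t - s) *\<^sub>R v)"
      using gradient_monotone[of "x + t *\<^sub>R v" "x + s *\<^sub>R v"] by (simp add: algebra_simps)
    then have "0 \<le> (t - s) * (v \<bullet> grad (x + t *\<^sub>R v) - v \<bullet> grad (x + s *\<^sub>R v))"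
      by (simp add: inner_diff_left inner_diff_right inner_commute right_diff_distrib)
    then show ?thesis using that by (simp add: zero_le_mult_iff)
  qed
  show ?thesis
  proof (rule ccontr)
    assume "\<not> ?thesis"
    then obtain d where "d > 0" and d: "\<forall>h>0. h < d \<longrightarrow> v \<bullet> grad (x + 0 *\<^sub>R v) > v \<bullet> grad (x + (0 + h) *\<^sub>R v)"
      using DERIV_neg_dec_right[OF D] by auto
    have "v \<bullet> grad (x + 0 *\<^sub>R v) > v \<bullet> grad (x + (0 + d / 2) *\<^sub>R v)"
      by (intro d[rule_format]) (use \<open>d > 0\<close> in auto)
    then show False
      using mono[of 0 "d/2"] \<open>d > 0\<close> by simp
  qed
qed

lemma approx_hessian_error: "norm (H x *v u - hess x *v u) \<le> \<delta> * norm u"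
proof -
  have "norm ((H x - hess x) *v u) \<le> \<delta> * norm u"
    using norm_matrix_vector_le[of "H x - hess x" u] hessian_approx[of x]
    by (meson mult_right_mono norm_ge_zero order_trans)
  then show ?thesis by (simp add: matrix_vector_mult_diff_rdistrib)
qed

text \<open>
  The true Hessian is positive semidefinite and \<open>H\<close> differs from it by at most \<open>\<delta>\<close>, so adding
  \<open>\<tau>\<close> leaves a coercivity constant of at least \<open>\<tau> - \<delta>\<close>.
\<close>

lemma inner_coercive: "u \<bullet> (H x *v u + \<tau> *\<^sub>R u) \<ge> (\<tau> - \<delta>) * (norm u)\<^sup>2"
proof -
  have "\<bar>u \<bullet> (H x *v u - hess x *v u)\<bar> \<le> norm u * (\<delta> * norm u)"
    by (meson Cauchy_Schwarz_ineq2 approx_hessian_error mult_left_mono norm_ge_zero order_trans)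
  then show ?thesis
    using hessian_psd[of u x]
    by (simp add: inner_add_right inner_diff_right algebra_simps power2_eq_square dot_square_norm)
qed

lemma norm_coercive: "(\<tau> - \<delta>) * norm u \<le> norm (H x *v u + \<tau> *\<^sub>R u)"
proof (cases "u = 0")
  case False
  have "(\<tau> - \<delta>) * (norm u)\<^sup>2 \<le> norm u * norm (H x *v u + \<tau> *\<^sub>R u)"
    using inner_coercive[of \<tau> u x] Cauchy_Schwarz_ineq2[of u "H x *v u + \<tau> *\<^sub>R u"] by linarith
  then have "norm u * ((\<tau> - \<delta>) * norm u) \<le> norm u * norm (H x *v u + \<tau> *\<^sub>R u)"
    by (simp add: power2_eq_square algebra_simps)
  then show ?thesis using False by (simp add: mult_le_cancel_left)
qed simp

lemma pos_def_regularized: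
  assumes "\<tau> > \<delta>"
  shows "pos_def (H x + mat \<tau>)"
  unfolding pos_def_def
proof (intro allI impI)
  fix v :: "real^'d" assume "v \<noteq> 0"
  then have "(\<tau> - \<delta>) * (norm v)\<^sup>2 > 0" using assms by simp
  then show "v \<bullet> ((H x + mat \<tau>) *v v) > 0"
    using inner_coercive[of \<tau> v x]
    by (simp add: matrix_vector_mult_add_rdistrib mat_mult_vector)
qed

text \<open>
  The mean value inequality along the segment, for a Hessian variation bounded by an affine
  function of the parameter. The affine form serves both the constant taken at the start point
  (\<open>a = 0\<close>) and the one taken at the end point (\<open>b < 0\<close>).
\<close>

lemma gradient_remainder:
  assumes "\<And>t. 0 < t \<Longrightarrow> t < 1 \<Longrightarrow> op_norm (hess (x + t *\<^sub>R s) - hess x) \<le> a + b * t"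
  shows "norm (grad (x + s) - grad x - hess x *v s) \<le> (a + b / 2) * norm s"
proof -
  let ?\<phi> = "\<lambda>t. grad (x + t *\<^sub>R s) - t *\<^sub>R (hess x *v s)"
  let ?\<psi> = "\<lambda>t. (a * t + b * t\<^sup>2 / 2) * norm s"
  have d: "(?\<phi> has_vector_derivative (hess (x + t *\<^sub>R s) *v s - hess x *v s)) (at t)" for t
    by (auto intro!: derivative_eq_intros gradient_along_line simp: gradient_differentiable)
  have e: "(?\<psi> has_vector_derivative ((a + b * t) * norm s)) (at t)" for t
    unfolding has_real_derivative_iff_has_vector_derivative[symmetric]
    by (auto intro!: derivative_eq_intros simp: algebra_simps)
  have "norm (?\<phi> 1 - ?\<phi> 0) \<le> ?\<psi> 1 - ?\<psi> 0"
  proof (rule differentiable_bound_general[OF zero_less_one _ _ d e])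
    show "continuous_on {0..1} ?\<phi>"
      by (intro continuous_at_imp_continuous_on ballI has_vector_derivative_continuous[OF d])
    show "continuous_on {0..1} ?\<psi>" by (intro continuous_intros) auto
    fix t :: real assume "0 < t" "t < 1"
    then have "op_norm (hess (x + t *\<^sub>R s) - hess x) * norm s \<le> (a + b * t) * norm s"
      by (intro mult_right_mono assms) auto
    then show "norm (hess (x + t *\<^sub>R s) *v s - hess x *v s) \<le> (a + b * t) * norm s"
      using norm_matrix_vector_le[of "hess (x + t *\<^sub>R s) - hess x" s]
      by (simp add: matrix_vector_mult_diff_rdistrib)
  qed
  then show ?thesis by (simp add: algebra_simps)
qed

text \<open>
  The smoothness condition is not symmetric in its two points, so the constant may be taken at
  whichever of them has the smaller gradient.
\<close>

lemma hessian_lipschitz_sym: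
  assumes "ereal (norm (y - x)) \<le> \<rho>"
  shows "op_norm (hess y - hess x) \<le> L y * norm (y - x)"
proof -
  have "op_norm (hess y - hess x) = op_norm (hess x - hess y)"
    unfolding op_norm_def matrix_vector_mult_diff_rdistrib
    using onorm_neg[of "\<lambda>v. hess y *v v - hess x *v v"] by simp
  also have "\<dots> \<le> L y * norm (x - y)"
    using assms by (intro hessian_lipschitz) (simp add: norm_minus_commute)
  finally show ?thesis by (simp add: norm_minus_commute)
qed

lemma gradient_remainder_start:
  assumes "ereal (norm s) \<le> \<rho>"
  shows "norm (grad (x + s) - grad x - hess x *v s) \<le> L x * (norm s)\<^sup>2 / 2"
proof -
  have "norm (grad (x + s) - grad x - hess x *v s) \<le> (0 + (L x * norm s) / 2) * norm s"
  proof (rule gradient_remainder)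
    fix t :: real assume t: "0 < t" "t < 1"
    then have "norm (x + t *\<^sub>R s - x) \<le> norm s" by (simp add: mult_left_le_one_le)
    then have "ereal (norm (x + t *\<^sub>R s - x)) \<le> \<rho>"
      using assms by (meson ereal_less_eq(3) order_trans)
    from hessian_lipschitz[OF this] t
    show "op_norm (hess (x + t *\<^sub>R s) - hess x) \<le> 0 + L x * norm s * t"
      by (simp add: algebra_simps)
  qed
  then show ?thesis by (simp add: power2_eq_square)
qed

lemma op_norm_triangle:
  fixes A B C :: "real^'d^'d"
  shows "op_norm (A - C) \<le> op_norm (A - B) + op_norm (B - C)"
proof -
  have "(*v) (A - C) = (\<lambda>v. (A - B) *v v + (B - C) *v v)"
    by (auto simp: matrix_vector_mult_diff_rdistrib)
  then show ?thesis
    unfolding op_norm_def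
    using onorm_triangle[OF matrix_vector_mul_bounded_linear[of "A - B"] matrix_vector_mul_bounded_linear[of "B - C"]]
    by simp
qed

text \<open>
  Here the constant is that of the end point. For \<open>0 < t < 1\<close> the Hessian at \<open>x + t s\<close> is
  compared with the one at \<open>x\<close> by way of the end point, at distances \<open>(1 - t) |s|\<close> and \<open>|s|\<close>;
  integrating \<open>2 - t\<close> gives the factor 3/2.
\<close>

lemma gradient_remainder_end:
  assumes "ereal (norm s) \<le> \<rho>"
  shows "norm (grad (x + s) - grad x - hess x *v s) \<le> 3 / 2 * L (x + s) * (norm s)\<^sup>2"
proof -
  let ?y = "x + s"
  have "norm (grad (x + s) - grad x - hess x *v s) \<le> (2 * L ?y * norm s + (- (L ?y * norm s)) / 2) * norm s"
  proof (rule gradient_remainder)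
    fix t :: real assume t: "0 < t" "t < 1"
    have e: "x + t *\<^sub>R s - ?y = - ((1 - t) *\<^sub>R s)" by (simp add: algebra_simps)
    then have n: "norm (x + t *\<^sub>R s - ?y) = (1 - t) * norm s" using t by simp
    also have "\<dots> \<le> norm s" using t by (simp add: mult_left_le_one_le)
    finally have "ereal (norm (x + t *\<^sub>R s - ?y)) \<le> \<rho>"
      using assms by (meson ereal_less_eq(3) order_trans)
    from hessian_lipschitz[OF this]
    have "op_norm (hess (x + t *\<^sub>R s) - hess ?y) \<le> L ?y * ((1 - t) * norm s)" using n by simp
    moreover have "op_norm (hess ?y - hess x) \<le> L ?y * norm s"
      using hessian_lipschitz_sym[of ?y x] assms by simp
    ultimately show "op_norm (hess (x + t *\<^sub>R s) - hess x) \<le> 2 * L ?y * norm s + (- (L ?y * norm s)) * t"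
      using op_norm_triangle[of "hess (x + t *\<^sub>R s)" "hess x" "hess ?y"]
      by (simp add: algebra_simps)
  qed
  then show ?thesis by (simp add: power2_eq_square algebra_simps)
qed

end

section \<open>Failed trials\<close>

text \<open>
  Both reasons for doubling the parameter are covered: the regularized matrix is not positive
  definite, or the residual test fails.
\<close>

definition ms_fails ::
  "(real^'d \<Rightarrow> real) \<Rightarrow> (real^'d \<Rightarrow> real^'d^'d) \<Rightarrow> real^'d \<Rightarrow> real \<Rightarrow> bool" where
  "ms_fails f H x \<tau> \<longleftrightarrow> (pos_def (H x + mat \<tau>) \<longrightarrow>
     norm (gradient f (x + ms_step f H x \<tau>) + \<tau> *\<^sub>R ms_step f H x \<tau>) > \<tau> / 2 * norm (ms_step f H x \<tau>))"

text \<open>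
  A loop that stops after \<open>j\<close> doublings has tried each parameter at most once, and unless
  \<open>j = 0\<close> the last parameter before the final one failed. All later bounds on \<open>j\<close> come from
  that single failure.
\<close>

lemma ms_trials_outcome:
  assumes "ms_trials f H x \<tau> r n"
  shows "\<exists>j. n \<le> Suc j \<and> (j = 0 \<or> ms_fails f H x (2 ^ j * \<tau> / 2)) \<and> pos_def (H x + mat (2 ^ j * \<tau>)) \<and>
    (let s = ms_step f H x (2 ^ j * \<tau>) in
      r = ZeroGradient (x + s) \<or>
      r = Accepted (x + s) (2 ^ j * \<tau>) \<and>
        norm (gradient f (x + s) + (2 ^ j * \<tau>) *\<^sub>R s) \<le> 2 ^ j * \<tau> / 2 * norm s)"
  using assms
proof induction
  case (not_pos_def \<tau> r n)
  then obtain j where j: "n \<le> Suc j" "j = 0 \<or> ms_fails f H x (2 ^ j * (2 * \<tau>) / 2)"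
      "pos_def (H x + mat (2 ^ j * (2 * \<tau>)))"
      "let s = ms_step f H x (2 ^ j * (2 * \<tau>)) in
      r = ZeroGradient (x + s) \<or>
      r = Accepted (x + s) (2 ^ j * (2 * \<tau>)) \<and>
        norm (gradient f (x + s) + (2 ^ j * (2 * \<tau>)) *\<^sub>R s) \<le> 2 ^ j * (2 * \<tau>) / 2 * norm s" by blast
  have "ms_fails f H x \<tau>" using not_pos_def.hyps unfolding ms_fails_def by simp
  with j show ?case
    by (intro exI[of _ "Suc j"]) (auto simp: mult.assoc mult.left_commute)
next
  case (rejected \<tau> s r n)
  then obtain j where j: "n \<le> Suc j" "j = 0 \<or> ms_fails f H x (2 ^ j * (2 * \<tau>) / 2)"
      "pos_def (H x + mat (2 ^ j * (2 * \<tau>)))"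
      "let s = ms_step f H x (2 ^ j * (2 * \<tau>)) in
      r = ZeroGradient (x + s) \<or>
      r = Accepted (x + s) (2 ^ j * (2 * \<tau>)) \<and>
        norm (gradient f (x + s) + (2 ^ j * (2 * \<tau>)) *\<^sub>R s) \<le> 2 ^ j * (2 * \<tau>) / 2 * norm s" by blast
  have "ms_fails f H x \<tau>" using rejected.hyps unfolding ms_fails_def by simp
  with j show ?case
    by (intro exI[of _ "Suc j"]) (auto simp: mult.assoc mult.left_commute)
next
  case (zero_gradient \<tau> s)
  then show ?case by (intro exI[of _ 0]) (auto simp: Let_def)
next
  case (accepted \<tau> s)
  then show ?case by (intro exI[of _ 0]) (auto simp: Let_def)
qed

lemma ms_backtrack_accepted:
  assumes "ms_backtrack f H x \<tau> (Accepted y \<tau>') h n"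
  shows "h = 1" and "\<exists>j. \<tau>' = 2 ^ j * \<tau> \<and> n \<le> j + 2 \<and> (j = 0 \<or> ms_fails f H x (\<tau>' / 2))"
    and "pos_def (H x + mat \<tau>')" and "y = x + ms_step f H x \<tau>'"
    and "norm (gradient f y + \<tau>' *\<^sub>R (y - x)) \<le> \<tau>' / 2 * norm (y - x)"
proof -
  from assms obtain n' where t: "h = 1" "n = Suc n'" "ms_trials f H x \<tau> (Accepted y \<tau>') n'"
    by cases auto
  from ms_trials_outcome[OF t(3)] obtain j where "n' \<le> Suc j"
      "j = 0 \<or> ms_fails f H x (2 ^ j * \<tau> / 2)" "\<tau>' = 2 ^ j * \<tau>"
    and *: "pos_def (H x + mat \<tau>')" "y = x + ms_step f H x \<tau>'"
      "norm (gradient f y + \<tau>' *\<^sub>R (y - x)) \<le> \<tau>' / 2 * norm (y - x)"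
    by (auto simp: Let_def)
  then show "\<exists>j. \<tau>' = 2 ^ j * \<tau> \<and> n \<le> j + 2 \<and> (j = 0 \<or> ms_fails f H x (\<tau>' / 2))"
    using t by (intro exI[of _ j]) auto
  show "h = 1" by fact
  show "pos_def (H x + mat \<tau>')" "y = x + ms_step f H x \<tau>'"
      "norm (gradient f y + \<tau>' *\<^sub>R (y - x)) \<le> \<tau>' / 2 * norm (y - x)" by fact+
qed

lemma ms_backtrack_zero:
  assumes "ms_backtrack f H x \<tau> (ZeroGradient p) h n"
  shows "h = 1" and "\<exists>j. n \<le> j + 2 \<and> (j = 0 \<or> ms_fails f H x (2 ^ j * \<tau> / 2))"
proof -
  from assms have "h = 1 \<and> (n = 1 \<or> (\<exists>n'. n = Suc n' \<and> ms_trials f H x \<tau> (ZeroGradient p) n'))"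
    by cases auto
  then show "h = 1" "\<exists>j. n \<le> j + 2 \<and> (j = 0 \<or> ms_fails f H x (2 ^ j * \<tau> / 2))"
    using ms_trials_outcome by fastforce+
qed

context convex_hessian_smooth begin

text \<open>
  The threshold above which a trial at \<open>x\<close> cannot fail.
\<close>

definition critical_tau :: "real^'d \<Rightarrow> real" where
  "critical_tau x = max (4 * \<delta>) (max (2 * sqrt (L x * norm (grad x)))
     (real_of_ereal (ereal (2 * norm (grad x)) / \<rho>)))"

definition r0 :: ereal where
  "r0 = min (\<rho> / 2) (1 / ereal (6 * sqrt M1))"

lemma r0_pos: "r0 > 0"
proof -
  have "\<rho> / 2 > 0" using radius_pos by (cases \<rho>) auto
  moreover have "1 / ereal (6 * sqrt M1) > 0"
    using M1_nonneg by (cases "M1 = 0") (auto simp: one_ereal_def)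
  ultimately show ?thesis unfolding r0_def by simp
qed

text \<open>
  What \<open>r0\<close> is made for: a step of length \<open>2 v\<close> with \<open>v \<le> r0\<close> stays in the region of
  smoothness, and the factor \<open>M1 (2 v)\<^sup>2\<close>, with which the gradient at its end point enters the
  Taylor remainder, is at most 1/9.
\<close>

lemma below_r0:
  assumes "0 \<le> v" "ereal v \<le> r0"
  shows "ereal (2 * v) \<le> \<rho>" and "M1 * v\<^sup>2 \<le> 1 / 36"
proof -
  have "ereal v \<le> \<rho> / 2" using assms unfolding r0_def by simp
  then show "ereal (2 * v) \<le> \<rho>" using radius_pos by (cases \<rho>) auto
  have v: "ereal v \<le> 1 / ereal (6 * sqrt M1)" using assms unfolding r0_def by simp
  show "M1 * v\<^sup>2 \<le> 1 / 36"
  proof (cases "M1 = 0")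
    case False
    then have "sqrt M1 > 0" using M1_nonneg by simp
    with v have "sqrt M1 * v \<le> 1 / 6" by (simp add: one_ereal_def field_simps)
    moreover have "0 \<le> sqrt M1 * v" using assms M1_nonneg by simp
    ultimately have "(sqrt M1 * v)\<^sup>2 \<le> (1 / 6)\<^sup>2" by (intro power_mono)
    then show ?thesis using M1_nonneg by (simp only: power_mult_distrib real_sqrt_pow2) (simp add: power2_eq_square)
  qed simp
qed

text \<open>
  By the linear system solved in the trial, the residual is the Taylor remainder of the
  gradient minus the error of the Hessian approximation.
\<close>

lemma residual_eq:
  assumes "pos_def (H x + mat \<tau>)" and "s = ms_step f H x \<tau>"
  shows "grad (x + s) + \<tau> *\<^sub>R s = (grad (x + s) - grad x - hess x *v s) - (H x *v s - hess x *v s)"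
  using ms_step_solves[where H=H and x=x and f=f, OF assms(1)] assms(2) by (simp add: algebra_simps)

lemma ms_step_norm:
  assumes "\<tau> > \<delta>"
  shows "(\<tau> - \<delta>) * norm (ms_step f H x \<tau>) \<le> norm (grad x)"
  using norm_coercive[of \<tau> "ms_step f H x \<tau>" x] ms_step_solves[where H=H and x=x and f=f, OF pos_def_regularized[OF assms]]
  by simp

text \<open>
  For \<open>\<tau>\<close> above the threshold the step is at most \<open>4/3 |grad x| / \<tau>\<close>; then the Hessian error
  and the Taylor remainder contribute at most \<open>\<tau>/4\<close> and \<open>\<tau>/6\<close> times the step length to the
  residual.
\<close>

lemma ms_fails_below_critical:
  assumes "\<tau> > 0" "ms_fails f H x \<tau>"
  shows "\<tau> < critical_tau x"
proof (rule ccontr)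
  assume "\<not> ?thesis"
  then have t: "4 * \<delta> \<le> \<tau>" "2 * sqrt (L x * norm (grad x)) \<le> \<tau>"
      "real_of_ereal (ereal (2 * norm (grad x)) / \<rho>) \<le> \<tau>"
    unfolding critical_tau_def by auto
  define s where "s = ms_step f H x \<tau>"
  have gt: "\<tau> > \<delta>" using t assms(1) delta_nonneg by linarith
  have pd: "pos_def (H x + mat \<tau>)" by (rule pos_def_regularized[OF gt])
  have "(3 / 4 * \<tau>) * norm s \<le> (\<tau> - \<delta>) * norm s"
    using t by (intro mult_right_mono) auto
  then have s: "3 / 4 * \<tau> * norm s \<le> norm (grad x)"
    using ms_step_norm[OF gt, of x] unfolding s_def by simp
  have radius: "ereal (norm s) \<le> \<rho>"
  proof (cases \<rho>)
    case (real p)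
    then have "p > 0" using radius_pos by simp
    then have "2 * norm (grad x) \<le> \<tau> * p" using t(3) real by (simp add: field_simps)
    then have "3 / 2 * (\<tau> * norm s) \<le> \<tau> * p" using s by linarith
    then have "\<tau> * (3 / 2 * norm s) \<le> \<tau> * p" by simp
    then have "3 / 2 * norm s \<le> p" using assms(1) by (simp only: mult_le_cancel_left_pos)
    then have "norm s \<le> p" using norm_ge_zero[of s] by linarith
    then show ?thesis using real by simp
  qed (use radius_pos in auto)
  have "L x * norm s \<le> \<tau> / 3"
  proof -
    have "sqrt (L x * norm (grad x)) \<le> \<tau> / 2" using t by simp
    then have "L x * norm (grad x) \<le> (\<tau> / 2)\<^sup>2"
      using assms(1) using L_nonneg[of x] by (simp add: sqrt_le_D)
    moreover have "L x * (3 / 4 * \<tau> * norm s) \<le> L x * norm (grad x)"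
      by (intro mult_left_mono s L_nonneg)
    ultimately have "\<tau> * (L x * norm s) \<le> \<tau> * (\<tau> / 3)"
      by (simp add: power2_eq_square mult_ac)
    then show ?thesis using assms(1) by (simp only: mult_le_cancel_left_pos)
  qed
  then have "L x * norm s * norm s \<le> \<tau> / 3 * norm s" by (intro mult_right_mono) auto
  moreover have "\<delta> * norm s \<le> \<tau> / 4 * norm s" using t by (intro mult_right_mono) auto
  moreover have "norm (grad (x + s) + \<tau> *\<^sub>R s) \<le> L x * (norm s)\<^sup>2 / 2 + \<delta> * norm s"
    unfolding residual_eq[OF pd s_def]
    using gradient_remainder_start[OF radius, of x] approx_hessian_error[of x s]
    by (meson add_mono norm_triangle_ineq4 order_trans)
  moreover have "norm (grad (x + s) + \<tau> *\<^sub>R s) > \<tau> / 2 * norm s"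
    using assms(2) pd unfolding ms_fails_def s_def by simp
  moreover have "0 \<le> \<tau> * norm s" using assms(1) by simp
  ultimately show False by (simp add: power2_eq_square)
qed

text \<open>
  The gradient at the end point of the trial is at most the residual plus \<open>\<tau> |s|\<close>. Inserting
  this into the end point form of the Taylor remainder gives an inequality for the residual in
  which, for a short step, the \<open>M1\<close>-part can be absorbed. What remains of a failed test is a
  lower bound for \<open>M0 |s|\<close>.
\<close>

lemma ms_fails_short_step:
  assumes "\<tau> > 0" "8 * \<delta> \<le> \<tau>" "ms_fails f H x \<tau>"
    and s: "s = ms_step f H x \<tau>" and small: "ereal (norm s / 2) \<le> r0"
  shows "\<tau> \<le> 12 * M0 * norm s"
proof -
  let ?e = "norm (grad (x + s) + \<tau> *\<^sub>R s)" and ?u = "norm s"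
  have pd: "pos_def (H x + mat \<tau>)"
    using assms(1,2) delta_nonneg by (intro pos_def_regularized) linarith
  have fail: "?e > \<tau> / 2 * ?u"
    using assms(3) pd unfolding ms_fails_def s by simp
  have radius: "ereal ?u \<le> \<rho>" and M1: "M1 * ?u\<^sup>2 \<le> 1 / 9"
    using below_r0[OF _ small] by (simp_all add: power2_eq_square)
  have g: "norm (grad (x + s)) \<le> ?e + \<tau> * ?u"
    using norm_triangle_ineq4[of "grad (x + s) + \<tau> *\<^sub>R s" "\<tau> *\<^sub>R s"] assms(1) by simp
  have "?e \<le> 3 / 2 * L (x + s) * ?u\<^sup>2 + \<delta> * ?u"
    unfolding residual_eq[OF pd s]
    using gradient_remainder_end[OF radius, of x] approx_hessian_error[of x s]
    by (meson add_mono norm_triangle_ineq4 order_trans)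
  also have "3 / 2 * L (x + s) * ?u\<^sup>2 = 3 / 2 * M0 * ?u\<^sup>2 + 3 / 2 * ((M1 * ?u\<^sup>2) * norm (grad (x + s)))"
    unfolding local_lipschitz_const_def by (simp add: algebra_simps)
  also have "(M1 * ?u\<^sup>2) * norm (grad (x + s)) \<le> 1 / 9 * (?e + \<tau> * ?u)"
    by (intro mult_mono M1 g) auto
  finally have "?e \<le> 3 / 2 * M0 * ?u\<^sup>2 + 3 / 2 * (1 / 9 * (?e + \<tau> * ?u)) + \<delta> * ?u"
    by simp
  then have e: "5 / 6 * ?e \<le> \<tau> * ?u / 6 + 3 / 2 * M0 * ?u\<^sup>2 + \<delta> * ?u"
    by (simp add: algebra_simps)
  have "\<delta> * ?u \<le> \<tau> / 8 * ?u" using assms(2) by (intro mult_right_mono) auto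
  then have main: "\<tau> * ?u / 8 < 3 / 2 * M0 * ?u\<^sup>2"
    using e fail by simp
  then have "?u \<noteq> 0" by auto
  then have "?u > 0" by simp
  moreover have "?u * \<tau> < ?u * (12 * M0 * ?u)" using main by (simp add: power2_eq_square mult_ac)
  ultimately show ?thesis by (simp only: mult_less_cancel_left_pos less_imp_le)
qed

text \<open>
  At the scale \<open>r0\<close> the threshold simplifies, because \<open>M1 r0\<^sup>2 \<le> 1/36\<close>, \<open>2 r0 \<le> \<rho>\<close>, and
  \<open>\<surd>(M0 |grad x|)\<close> is a geometric mean of \<open>M0 r0\<close> and \<open>|grad x| / r0\<close>.
\<close>

lemma ms_fails_tau_bound:
  assumes "\<tau> > 0" "8 * \<delta> \<le> \<tau>" "ms_fails f H x \<tau>" and r: "r0 = ereal r"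
  shows "\<tau> \<le> 4 / 3 * (M0 * r + norm (grad x) / r)"
proof -
  let ?g = "norm (grad x)"
  have "r > 0" using r0_pos r by simp
  then have r': "ereal (2 * r) \<le> \<rho>" "M1 * r\<^sup>2 \<le> 1 / 36"
    using below_r0[of r] r by auto
  define a b where "a = M0 * r" and "b = ?g / r"
  have ab: "a \<ge> 0" "b \<ge> 0" unfolding a_def b_def using M0_nonneg \<open>r > 0\<close> by auto
  have g: "?g = b * r" unfolding b_def using \<open>r > 0\<close> by simp
  have "\<tau> < critical_tau x" by (rule ms_fails_below_critical) fact+
  moreover have "\<tau> \<ge> 4 * \<delta>" using assms(2) delta_nonneg by linarith
  ultimately consider "\<tau> < 2 * sqrt (L x * ?g)" | "\<tau> < real_of_ereal (ereal (2 * ?g) / \<rho>)"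
    unfolding critical_tau_def by fastforce
  then show ?thesis
  proof cases
    case 1
    have "L x * ?g = a * b + (M1 * r\<^sup>2) * b\<^sup>2"
      unfolding local_lipschitz_const_def g a_def by (simp add: algebra_simps power2_eq_square)
    also have "\<dots> \<le> a * b + 1 / 36 * b\<^sup>2"
      by (intro add_left_mono mult_right_mono r') simp
    also have "\<dots> \<le> (2 / 3 * (a + b))\<^sup>2"
    proof -
      have "0 \<le> (a / 2 - b / 2)\<^sup>2" "0 \<le> a\<^sup>2" "0 \<le> b\<^sup>2" by simp_all
      moreover have "(a / 2 - b / 2)\<^sup>2 = a\<^sup>2 / 4 - a * b / 2 + b\<^sup>2 / 4"
        "(2 / 3 * (a + b))\<^sup>2 = 4 / 9 * a\<^sup>2 + 8 / 9 * (a * b) + 4 / 9 * b\<^sup>2"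
        by (simp_all add: power2_eq_square field_simps)
      moreover have "0 \<le> a * b" using ab by simp
      ultimately show ?thesis by linarith
    qed
    finally have "sqrt (L x * ?g) \<le> 2 / 3 * (a + b)"
      using ab by (intro real_le_lsqrt) auto
    then show ?thesis using 1 unfolding a_def b_def by simp
  next
    case 2
    have "real_of_ereal (ereal (2 * ?g) / \<rho>) \<le> b"
    proof (cases \<rho>)
      case (real p)
      then have "2 * r \<le> p" using r' by simp
      then have "2 * ?g / p \<le> 2 * ?g / (2 * r)" using \<open>r > 0\<close> by (intro divide_left_mono) auto
      then show ?thesis using real radius_pos unfolding b_def by simp
    qed (use ab radius_pos in auto)
    then show ?thesis using 2 ab unfolding a_def b_def by simp
  qed
qed

text \<open>
  The three possible reasons for which a parameter \<open>\<tau>\<close> at \<open>x\<close> could not be halved; \<open>q\<close> is a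
  length witnessing a long trial step.
\<close>

definition tau_excess :: "real^'d \<Rightarrow> real \<Rightarrow> real \<Rightarrow> bool" where
  "tau_excess x \<tau> q \<longleftrightarrow> \<tau> \<le> 16 * \<delta> \<or> \<tau> \<le> 48 * M0 * q \<or>
     (\<exists>r. r0 = ereal r \<and> r < q \<and> \<tau> \<le> 8 / 3 * (M0 * r + norm (grad x) / r))"

lemma tau_excess_mono: "tau_excess x \<tau> q \<Longrightarrow> q \<le> q' \<Longrightarrow> tau_excess x \<tau> q'"
  unfolding tau_excess_def using M0_nonneg
  by (smt (verit, ccfv_SIG) mult_left_mono)

lemma tau_excess_of_fails:
  assumes "\<tau> > 0" "ms_fails f H x \<tau>"
  shows "tau_excess x (2 * \<tau>) (norm (ms_step f H x \<tau>) / 2)"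
proof (cases "8 * \<delta> \<le> \<tau>")
  case True
  let ?q = "norm (ms_step f H x \<tau>) / 2"
  show ?thesis
  proof (cases "ereal ?q \<le> r0")
    case small: True
    have "\<tau> \<le> 12 * M0 * norm (ms_step f H x \<tau>)"
      by (rule ms_fails_short_step[OF assms(1) True assms(2) refl small])
    then show ?thesis unfolding tau_excess_def by simp
  next
    case False
    then obtain r where r: "r0 = ereal r" using r0_pos by (cases r0) auto
    with False have "r < ?q" by simp
    with r ms_fails_tau_bound[OF assms(1) True assms(2) r] show ?thesis
      unfolding tau_excess_def by auto
  qed
qed (auto simp: tau_excess_def)

text \<open>
  Subtracting the two linear systems gives \<open>(H + \<tau>)(s' - s) = \<tau> s\<close>, and \<open>H + \<tau>\<close> is coercive.
  So the failed step, of which nothing is kept, is controlled by the accepted one, which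
  enters the energy.
\<close>

lemma ms_step_doubled:
  assumes "\<tau> > 0" "8 * \<delta> \<le> \<tau>"
  shows "norm (ms_step f H x \<tau>) \<le> 15 / 7 * norm (ms_step f H x (2 * \<tau>))"
proof -
  let ?s' = "ms_step f H x \<tau>" and ?s = "ms_step f H x (2 * \<tau>)"
  have pd: "pos_def (H x + mat \<tau>)" "pos_def (H x + mat (2 * \<tau>))"
    using assms delta_nonneg by (intro pos_def_regularized; linarith)+
  have e: "H x *v (?s' - ?s) + \<tau> *\<^sub>R (?s' - ?s) = \<tau> *\<^sub>R ?s"
  proof -
    have "H x *v (?s' - ?s) + \<tau> *\<^sub>R (?s' - ?s) =
      (H x *v ?s' + \<tau> *\<^sub>R ?s') - (H x *v ?s + (2 * \<tau>) *\<^sub>R ?s) + \<tau> *\<^sub>R ?s"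
      by (simp add: matrix_vector_mult_diff_distrib algebra_simps flip: scaleR_2)
    then show ?thesis using ms_step_solves[where H=H and x=x and f=f, OF pd(1)] ms_step_solves[where H=H and x=x and f=f, OF pd(2)] by simp
  qed
  have "\<tau> * (7 / 8 * norm (?s' - ?s)) \<le> (\<tau> - \<delta>) * norm (?s' - ?s)"
    using mult_right_mono[of "7 / 8 * \<tau>" "\<tau> - \<delta>" "norm (?s' - ?s)"] assms(2) by simp
  also have "\<dots> \<le> \<tau> * norm ?s"
    using norm_coercive[of \<tau> "?s' - ?s" x] assms(1) unfolding e by simp
  finally have "7 / 8 * norm (?s' - ?s) \<le> norm ?s"
    using assms(1) by (simp only: mult_le_cancel_left_pos)
  then show ?thesis
    using norm_triangle_sub[of ?s' ?s] by simp
qed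

text \<open>
  The factor is \<open>15/7 * 1/2\<close>: the failed step is at most 15/7 times the accepted one, and \<open>q\<close>
  is half its length.
\<close>

lemma tau_excess_accepted:
  assumes "\<tau> > 0" "ms_fails f H x (\<tau> / 2)"
  shows "tau_excess x \<tau> (15 / 14 * norm (ms_step f H x \<tau>))"
proof (cases "8 * \<delta> \<le> \<tau> / 2")
  case True
  have "tau_excess x (2 * (\<tau> / 2)) (norm (ms_step f H x (\<tau> / 2)) / 2)"
    by (rule tau_excess_of_fails) (use assms in auto)
  moreover have "norm (ms_step f H x (\<tau> / 2)) / 2 \<le> 15 / 14 * norm (ms_step f H x \<tau>)"
    using ms_step_doubled[of "\<tau> / 2" x] True assms(1) by simp
  ultimately show ?thesis by (simp add: tau_excess_mono)
qed (auto simp: tau_excess_def)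

text \<open>
  The smoothness constant at the minimizer is just \<open>M0\<close>. Hence \<open>xs - x\<close> nearly solves the
  unregularized system, and coercivity bounds its distance to the trial step.
\<close>

lemma ms_step_le_distance:
  assumes "\<tau> > 0" "8 * \<delta> \<le> \<tau>" "24 * M0 * norm (x - xs) \<le> \<tau>" "ereal (norm (x - xs)) \<le> \<rho>"
  shows "norm (ms_step f H x \<tau>) \<le> 12 / 5 * norm (x - xs)"
proof -
  let ?s = "ms_step f H x \<tau>" and ?D = "norm (x - xs)"
  define d where "d = xs - x"
  have nd: "norm d = ?D" unfolding d_def by (simp add: norm_minus_commute)
  have pd: "pos_def (H x + mat \<tau>)"
    using assms delta_nonneg by (intro pos_def_regularized) linarith
  have e: "H x *v (?s - d) + \<tau> *\<^sub>R (?s - d) =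
      (grad (x + d) - grad x - hess x *v d) - (H x *v d - hess x *v d) - \<tau> *\<^sub>R d"
  proof -
    have "H x *v (?s - d) + \<tau> *\<^sub>R (?s - d) = (H x *v ?s + \<tau> *\<^sub>R ?s) - H x *v d - \<tau> *\<^sub>R d"
      by (simp add: matrix_vector_mult_diff_distrib algebra_simps)
    then show ?thesis
      using ms_step_solves[where H=H and x=x and f=f, OF pd] gradient_at_minimizer unfolding d_def by simp
  qed
  have "(\<tau> - \<delta>) * norm (?s - d) \<le> norm (H x *v (?s - d) + \<tau> *\<^sub>R (?s - d))"
    by (rule norm_coercive)
  also have "\<dots> \<le> norm (grad (x + d) - grad x - hess x *v d) + norm (H x *v d - hess x *v d) + norm (\<tau> *\<^sub>R d)"
    unfolding e by (meson add_right_mono norm_triangle_ineq4 order_trans)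
  also have "\<dots> \<le> 3 / 2 * L (x + d) * (norm d)\<^sup>2 + \<delta> * norm d + \<tau> * norm d"
    using gradient_remainder_end[of d x] approx_hessian_error[of x d] assms nd by simp
  also have "L (x + d) = M0"
    unfolding local_lipschitz_const_def d_def by (simp add: gradient_at_minimizer)
  also have "3 / 2 * M0 * (norm d)\<^sup>2 \<le> \<tau> / 16 * norm d"
    using mult_right_mono[OF assms(3), of "norm d"] nd by (simp add: power2_eq_square)
  also have "\<delta> * norm d \<le> \<tau> / 8 * norm d" using assms(2) by (intro mult_right_mono) auto
  finally have "(\<tau> - \<delta>) * norm (?s - d) \<le> \<tau> * (19 / 16 * ?D)" using nd by simp
  moreover have "\<tau> * (7 / 8 * norm (?s - d)) \<le> (\<tau> - \<delta>) * norm (?s - d)"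
    using mult_right_mono[of "7 / 8 * \<tau>" "\<tau> - \<delta>" "norm (?s - d)"] assms(2) by simp
  ultimately have "\<tau> * (7 / 8 * norm (?s - d)) \<le> \<tau> * (19 / 16 * ?D)" by linarith
  then have "7 / 8 * norm (?s - d) \<le> 19 / 16 * ?D"
    using assms(1) by (simp only: mult_le_cancel_left_pos)
  then show ?thesis using norm_triangle_sub[of ?s d] nd norm_ge_zero[of "x - xs"] by linarith
qed

text \<open>
  Outside the region of smoothness the distance exceeds \<open>2 r0\<close>, and the short-step and the
  long-step alternative both follow directly; inside, the trial step is bounded by the
  distance.
\<close>

lemma tau_excess_distance:
  assumes "\<tau> > 0" "ms_fails f H x (\<tau> / 2)"
  shows "tau_excess x \<tau> (6 / 5 * norm (x - xs))"
proof -
  let ?D = "norm (x - xs)"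
  have t: "tau_excess x \<tau> (norm (ms_step f H x (\<tau> / 2)) / 2)"
    using tau_excess_of_fails[of "\<tau> / 2" x] assms by simp
  consider "\<tau> / 2 < 8 * \<delta>" | "\<tau> / 2 < 24 * M0 * ?D"
    | "norm (ms_step f H x (\<tau> / 2)) / 2 \<le> 6 / 5 * ?D"
    | "8 * \<delta> \<le> \<tau> / 2" "\<rho> < ereal ?D"
    using ms_step_le_distance[of "\<tau> / 2" x] assms(1) by fastforce
  then show ?thesis
  proof cases
    case 1
    then show ?thesis unfolding tau_excess_def by simp
  next
    case 2
    moreover have "0 \<le> M0 * ?D" using M0_nonneg by simp
    ultimately show ?thesis unfolding tau_excess_def by simp
  next
    case 3
    with t show ?thesis by (rule tau_excess_mono)
  next
    case 4
    then obtain p where p: "\<rho> = ereal p" "p < ?D" using radius_pos by (cases \<rho>) auto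
    have "r0 \<le> \<rho> / 2" unfolding r0_def by simp
    then obtain r where r: "r0 = ereal r" "2 * r < ?D" "r > 0"
      using p r0_pos by (cases r0) auto
    show ?thesis
    proof (cases "ereal (norm (ms_step f H x (\<tau> / 2)) / 2) \<le> r0")
      case True
      then have "norm (ms_step f H x (\<tau> / 2)) / 2 \<le> 6 / 5 * ?D" using r by simp
      with t show ?thesis by (rule tau_excess_mono)
    next
      case False
      have "\<tau> / 2 \<le> 4 / 3 * (M0 * r + norm (grad x) / r)"
        by (rule ms_fails_tau_bound) (use assms 4 r in auto)
      then show ?thesis unfolding tau_excess_def using r by auto
    qed
  qed
qed

lemma ms_trials_terminate:
  assumes "\<tau> > 0"
  shows "\<exists>r n. ms_trials f H x \<tau> r n"
proof -
  obtain m :: nat where "critical_tau x / \<tau> < 2 ^ m"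
    using real_arch_pow[of 2] by auto
  then have "critical_tau x \<le> 2 ^ m * \<tau>" using assms by (simp add: field_simps)
  then show ?thesis using assms
  proof (induction m arbitrary: \<tau>)
    case 0
    then have nf: "\<not> ms_fails f H x \<tau>" using ms_fails_below_critical[of \<tau> x] by auto
    then have "pos_def (H x + mat \<tau>)" unfolding ms_fails_def by blast
    then show ?case
      using nf ms_trials.zero_gradient[of H x \<tau> _ f] ms_trials.accepted[of H x \<tau> _ f]
      unfolding ms_fails_def by (metis linorder_not_less)
  next
    case (Suc m)
    then have "critical_tau x \<le> 2 ^ m * (2 * \<tau>)" "0 < 2 * \<tau>" by (simp_all add: mult_ac)
    from Suc.IH[OF this] obtain r n where "ms_trials f H x (2 * \<tau>) r n" by blast
    then show ?case
      using ms_trials.intros[of H x \<tau>] by metis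
  qed
qed

lemma ms_backtrack_terminates:
  assumes "\<tau> > 0"
  shows "\<exists>r h n. ms_backtrack f H x \<tau> r h n"
  using ms_trials_terminate[OF assms, of x] ms_backtrack.intros[of f x] by metis

section \<open>Energy of an iteration\<close>

lemma npe_a_quadratic:
  assumes "\<eta> > 0" "A > 0"
  shows "npe_a \<eta> A > 0" and "\<eta> * (npe_a \<eta> A)\<^sup>2 = A + npe_a \<eta> A"
proof -
  let ?r = "sqrt (1 + 4 * \<eta> * A)"
  have r2: "?r\<^sup>2 = 1 + 4 * \<eta> * A" using assms by simp
  show "npe_a \<eta> A > 0" unfolding npe_a_def using assms by (intro divide_pos_pos add_pos_nonneg) auto
  show "\<eta> * (npe_a \<eta> A)\<^sup>2 = A + npe_a \<eta> A"
    unfolding npe_a_def using assms r2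
    by (simp add: power_divide power2_sum field_simps) (simp add: power2_eq_square algebra_simps)
qed

text \<open>
  The squared residual test with \<open>\<tau>\<close> divided out; \<open>3/8 = (1 - 1/4)/2\<close>.
\<close>

lemma ms_certificate:
  assumes "\<tau> > 0" and "norm (g + \<tau> *\<^sub>R (y - v)) \<le> \<tau> / 2 * norm (y - v)"
  shows "g \<bullet> (y - v) + (norm g)\<^sup>2 / (2 * \<tau>) \<le> - (3 / 8) * \<tau> * (norm (y - v))\<^sup>2"
proof -
  let ?s = "y - v"
  have "(norm (g + \<tau> *\<^sub>R ?s))\<^sup>2 \<le> (\<tau> / 2 * norm ?s)\<^sup>2" using assms by (intro power_mono) auto
  moreover have "(norm (g + \<tau> *\<^sub>R ?s))\<^sup>2 = (norm g)\<^sup>2 + 2 * \<tau> * (g \<bullet> ?s) + \<tau>\<^sup>2 * (norm ?s)\<^sup>2"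
    by (simp only: power2_norm_eq_inner) (simp add: inner_add inner_commute power2_eq_square algebra_simps)
  moreover have "(\<tau> / 2 * norm ?s)\<^sup>2 = \<tau>\<^sup>2 * (norm ?s)\<^sup>2 / 4"
    by (simp add: power_mult_distrib power_divide)
  moreover have "2 * \<tau> * (g \<bullet> ?s + (norm g)\<^sup>2 / (2 * \<tau>)) = 2 * \<tau> * (g \<bullet> ?s) + (norm g)\<^sup>2"
    using assms(1) by (simp add: distrib_left)
  moreover have "2 * \<tau> * (- (3 / 8) * \<tau> * (norm ?s)\<^sup>2) = - (3 / 4) * (\<tau>\<^sup>2 * (norm ?s)\<^sup>2)"
    by (simp add: power2_eq_square)
  ultimately have "2 * \<tau> * (g \<bullet> ?s + (norm g)\<^sup>2 / (2 * \<tau>)) \<le> 2 * \<tau> * (- (3 / 8) * \<tau> * (norm ?s)\<^sup>2)"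
    by linarith
  then show ?thesis by (rule mult_left_le_imp_le) (use assms(1) in simp)
qed

definition energy :: "real^'d \<Rightarrow> real^'d \<Rightarrow> real \<Rightarrow> real" where
  "energy w z A = A * (f w - f xs) + (norm (z - xs))\<^sup>2 / 2"

text \<open>
  \<open>S\<close> sums \<open>A' \<eta> |y - v|\<^sup>2\<close> over the iterations so far, so \<open>3/8 S\<close> is the energy spent, and
  \<open>Q\<close> the sum of the squared increments of \<open>A\<close>. The last conjunct is the Cauchy-Schwarz form
  of the distance bound for \<open>w\<close>: \<open>A (w - xs)\<close> is a sum of terms \<open>\<gamma> a (z - xs)\<close>, with
  \<open>|z - xs| \<le> R\<close>, and \<open>\<gamma> A' (y - v)\<close>, whose norm is the increment \<open>\<gamma> a\<close> of \<open>A\<close> times the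
  square root of the iteration's contribution to \<open>S\<close>.
\<close>

definition tracked :: "real \<Rightarrow> real \<Rightarrow> real \<Rightarrow> real^'d \<Rightarrow> real^'d \<Rightarrow> real \<Rightarrow> bool" where
  "tracked R S Q w z A \<longleftrightarrow> A > 0 \<and> 0 \<le> S \<and> 0 \<le> Q \<and> Q \<le> A\<^sup>2 \<and>
     energy w z A + 3 / 8 * S \<le> R\<^sup>2 / 2 \<and>
     norm (A *\<^sub>R (w - xs)) \<le> A * R + sqrt Q * sqrt S"

text \<open>
  The initialization is an iteration from \<open>A = 0\<close> with \<open>\<gamma> = 1\<close>.
\<close>

lemma tracked_init:
  assumes "\<eta> > 0" and ms: "norm (grad w + \<eta> *\<^sub>R (w - x0)) \<le> \<eta> / 2 * norm (w - x0)"
  shows "tracked (norm (x0 - xs)) ((norm (w - x0))\<^sup>2) ((1 / \<eta>)\<^sup>2) w (x0 - (1 / \<eta>) *\<^sub>R grad w) (1 / \<eta>)"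
proof -
  let ?g = "grad w" and ?a = "1 / \<eta>" and ?R = "norm (x0 - xs)"
  have a: "?a > 0" using assms by simp
  have "f w - f xs \<le> ?g \<bullet> (w - xs)" using above_tangent[of w xs] by (simp add: inner_diff_right)
  then have 1: "?a * (f w - f xs) \<le> ?a * (?g \<bullet> (w - xs))" using a by (intro mult_left_mono) auto
  have 2: "(norm (x0 - ?a *\<^sub>R ?g - xs))\<^sup>2 = ?R\<^sup>2 - 2 * ?a * (?g \<bullet> (x0 - xs)) + ?a\<^sup>2 * (norm ?g)\<^sup>2"
  proof -
    have "x0 - ?a *\<^sub>R ?g - xs = (x0 - xs) - ?a *\<^sub>R ?g" by simp
    then show ?thesis
      by (simp only: power2_norm_eq_inner)
        (simp only: inner_diff inner_scaleR_left inner_scaleR_right, simp add: inner_commute algebra_simps power2_eq_square)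
  qed
  have "?a * (?g \<bullet> (w - x0) + (norm ?g)\<^sup>2 / (2 * \<eta>)) \<le> ?a * (- (3 / 8) * \<eta> * (norm (w - x0))\<^sup>2)"
    using a by (intro mult_left_mono ms_certificate[OF assms]) auto
  then have 3: "?a * (?g \<bullet> (w - x0)) + ?a\<^sup>2 * (norm ?g)\<^sup>2 / 2 \<le> - (3 / 8) * (norm (w - x0))\<^sup>2"
    using assms by (simp add: field_simps power2_eq_square)
  have 4: "?a * (?g \<bullet> (w - xs)) = ?a * (?g \<bullet> (w - x0)) + ?a * (?g \<bullet> (x0 - xs))"
    by (simp add: inner_diff_right algebra_simps)
  have en: "energy w (x0 - ?a *\<^sub>R ?g) ?a + 3 / 8 * (norm (w - x0))\<^sup>2 \<le> ?R\<^sup>2 / 2"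
    unfolding energy_def using 1 2 3 4 by linarith
  have "norm (w - xs) \<le> ?R + norm (w - x0)" using norm_triangle_ineq[of "x0 - xs" "w - x0"] by simp
  then have "norm (?a *\<^sub>R (w - xs)) \<le> ?a * ?R + sqrt (?a\<^sup>2) * sqrt ((norm (w - x0))\<^sup>2)"
    using a mult_left_mono[of "norm (w - xs)" "?R + norm (w - x0)" ?a] by (simp add: distrib_left)
  then show ?thesis unfolding tracked_def using a en by simp
qed

lemma sqrt_Cauchy_two:
  assumes "0 \<le> Q" "0 \<le> S" "0 \<le> q" "0 \<le> s"
  shows "sqrt Q * sqrt S + sqrt q * sqrt s \<le> sqrt (Q + q) * sqrt (S + s)"
proof -
  have "(sqrt Q * sqrt S + sqrt q * sqrt s)\<^sup>2 \<le> (Q + q) * (S + s)"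
  proof -
    have "0 \<le> (sqrt Q * sqrt s - sqrt q * sqrt S)\<^sup>2" by simp
    then have "2 * (sqrt Q * sqrt S * sqrt q * sqrt s) \<le> Q * s + q * S"
      using assms by (simp add: power2_diff power_mult_distrib algebra_simps)
    moreover have "(sqrt Q * sqrt S + sqrt q * sqrt s)\<^sup>2 = Q * S + q * s + 2 * (sqrt Q * sqrt S * sqrt q * sqrt s)"
      using assms by (simp add: power2_sum power_mult_distrib algebra_simps)
    ultimately show ?thesis by (simp add: algebra_simps)
  qed
  then show ?thesis by (simp add: real_le_rsqrt flip: real_sqrt_mult)
qed

lemma tracked_z:
  assumes "tracked R S Q w z A" "0 \<le> R"
  shows "norm (z - xs) \<le> R"
proof -
  have "0 \<le> A * (f w - f xs)" using assms minimizer[of w] unfolding tracked_def by simp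
  then have "(norm (z - xs))\<^sup>2 \<le> R\<^sup>2" using assms(1) unfolding tracked_def energy_def by simp
  then show ?thesis using assms(2) power2_le_imp_le by blast
qed

lemma tracked_S:
  assumes "tracked R S Q w z A"
  shows "S \<le> 4 / 3 * R\<^sup>2"
proof -
  have "0 \<le> A * (f w - f xs)" using assms minimizer[of w] unfolding tracked_def by simp
  then show ?thesis using assms zero_le_power2[of "norm (z - xs)"]
    unfolding tracked_def energy_def by linarith
qed

text \<open>
  The Cauchy-Schwarz term is at most \<open>A \<surd>S \<le> A (2/\<surd>3) R\<close>.
\<close>

lemma tracked_w:
  assumes t: "tracked R S Q w z A" and "0 \<le> R"
  shows "norm (w - xs) \<le> (1 + 2 / sqrt 3) * R"
proof -
  have A: "A > 0" "Q \<le> A\<^sup>2" "0 \<le> S" using t unfolding tracked_def by auto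
  have "sqrt S \<le> sqrt (4 / 3 * R\<^sup>2)" using tracked_S[OF t] by simp
  also have "\<dots> = 2 / sqrt 3 * R" using assms(2) by (simp add: real_sqrt_mult real_sqrt_divide)
  finally have S: "sqrt S \<le> 2 / sqrt 3 * R" .
  have "sqrt Q \<le> A" using A by (simp add: real_le_lsqrt)
  then have "sqrt Q * sqrt S \<le> A * (2 / sqrt 3 * R)" using A S by (intro mult_mono) auto
  moreover have "A * norm (w - xs) \<le> A * R + sqrt Q * sqrt S"
  proof -
    have "A * norm (w - xs) = norm (A *\<^sub>R (w - xs))" using A by simp
    then show ?thesis using t unfolding tracked_def by argo
  qed
  ultimately have "A * norm (w - xs) \<le> A * ((1 + 2 / sqrt 3) * R)"
    unfolding distrib_left distrib_right by linarith
  then show ?thesis using A by (simp only: mult_le_cancel_left_pos)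
qed

lemma tracked_v:
  assumes t: "tracked R S Q w z A" and "0 \<le> R" "\<eta> > 0"
  shows "norm (npe_v \<eta> A w z - xs) \<le> (1 + 2 / sqrt 3) * R"
proof -
  let ?a = "npe_a \<eta> A" and ?C = "(1 + 2 / sqrt 3) * R"
  have A: "A > 0" using t unfolding tracked_def by auto
  have a: "?a > 0" by (rule npe_a_quadratic[OF assms(3) A])
  have "norm (z - xs) \<le> ?C"
  proof -
    have "0 \<le> 2 / sqrt 3 * R" using assms(2) by simp
    then show ?thesis using tracked_z[OF t assms(2)] unfolding distrib_right by linarith
  qed
  then have sum_le: "norm (A *\<^sub>R (w - xs) + ?a *\<^sub>R (z - xs)) \<le> A * ?C + ?a * ?C"
    using tracked_w[OF t assms(2)] A a
    by (intro order_trans[OF norm_triangle_ineq] add_mono) (auto intro!: mult_left_mono)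
  have "npe_v \<eta> A w z - xs = (A *\<^sub>R (w - xs) + ?a *\<^sub>R (z - xs)) /\<^sub>R (A + ?a)"
  proof -
    have "xs = ((A + ?a) *\<^sub>R xs) /\<^sub>R (A + ?a)" using A a by simp
    then have "npe_v \<eta> A w z - xs = (A *\<^sub>R w + ?a *\<^sub>R z) /\<^sub>R (A + ?a) - ((A + ?a) *\<^sub>R xs) /\<^sub>R (A + ?a)"
      unfolding npe_v_def by presburger
    then show ?thesis by (simp only: scaleR_diff_right[symmetric]) (simp add: algebra_simps)
  qed
  then have "A *\<^sub>R (w - xs) + ?a *\<^sub>R (z - xs) = (A + ?a) *\<^sub>R (npe_v \<eta> A w z - xs)" using A a by simp
  with sum_le have "norm ((A + ?a) *\<^sub>R (npe_v \<eta> A w z - xs)) \<le> (A + ?a) * ?C"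
    by (simp only: distrib_right)
  then have "(A + ?a) * norm (npe_v \<eta> A w z - xs) \<le> (A + ?a) * ?C" using A a by simp
  then show ?thesis by (rule mult_left_le_imp_le) (use A a in simp)
qed

text \<open>
  Convexity at \<open>y\<close> is used against \<open>w\<close> and against \<open>xs\<close>; the definition of \<open>v\<close> cancels the
  terms with \<open>z\<close>. What is left is \<open>\<gamma> A'\<close> times the left-hand side of \<open>ms_certificate\<close>, since
  \<open>\<eta> a\<^sup>2 = A + a\<close> turns \<open>(\<gamma> a)\<^sup>2\<close> into \<open>\<gamma> A' / \<tau>\<close>.
\<close>

lemma tracked_step:
  fixes w z y :: "real^'d"
  assumes t: "tracked R S Q w z A" and R: "0 \<le> R" and \<eta>: "0 < \<eta>" "\<eta> \<le> \<tau>"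
    and v: "v = npe_v \<eta> A w z" and a: "a = npe_a \<eta> A" and \<gamma>: "\<gamma> = \<eta> / \<tau>"
    and ms: "norm (grad y + \<tau> *\<^sub>R (y - v)) \<le> \<tau> / 2 * norm (y - v)"
    and A': "A' = A + \<gamma> * a"
    and w': "w' = (((1 - \<gamma>) * A) *\<^sub>R w + (\<gamma> * (A + a)) *\<^sub>R y) /\<^sub>R A'"
    and z': "z' = z - (\<gamma> * a) *\<^sub>R grad y"
  shows "tracked R (S + (A + a) * \<eta> * (norm (y - v))\<^sup>2) (Q + (\<gamma> * a)\<^sup>2) w' z' A'"
proof -
  have A: "A > 0" "0 \<le> S" "0 \<le> Q" "Q \<le> A\<^sup>2" and en: "energy w z A + 3 / 8 * S \<le> R\<^sup>2 / 2"
    and nw: "norm (A *\<^sub>R (w - xs)) \<le> A * R + sqrt Q * sqrt S"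
    using t unfolding tracked_def by auto
  have a0: "a > 0" and quad: "\<eta> * a\<^sup>2 = A + a"
    unfolding a using npe_a_quadratic[OF \<eta>(1) A(1)] by auto
  have \<tau>: "\<tau> > 0" using \<eta> by simp
  have g: "0 < \<gamma>" "\<gamma> \<le> 1" "\<gamma> * \<tau> = \<eta>" unfolding \<gamma> using \<eta> \<tau> by auto
  have A'0: "A' > 0" unfolding A' using A a0 g by (simp add: add_pos_pos)
  have Av: "(A + a) *\<^sub>R v = A *\<^sub>R w + a *\<^sub>R z"
    unfolding v npe_v_def a[symmetric] using A a0 by simp
  let ?G = "grad y" and ?r = "norm (y - v)"
  have fw: "A' * f w' \<le> (1 - \<gamma>) * A * f w + \<gamma> * (A + a) * f y"
  proof -
    let ?\<theta> = "\<gamma> * (A + a) / A'"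
    have "1 - ?\<theta> = ((1 - \<gamma>) * A) / A'" unfolding A' using A'0 A' by (simp add: field_simps)
    then have "w' = (1 - ?\<theta>) *\<^sub>R w + ?\<theta> *\<^sub>R y"
      unfolding w' by (simp add: scaleR_add_right divide_inverse mult.commute)
    moreover have "0 \<le> ?\<theta>" using A a0 g A'0 by simp
    moreover have "?\<theta> \<le> 1"
    proof -
      have "\<gamma> * A \<le> 1 * A" using A g by (intro mult_right_mono) auto
      then show ?thesis using A'0 unfolding A' by (simp add: algebra_simps)
    qed
    ultimately have "f w' \<le> (1 - ?\<theta>) * f w + ?\<theta> * f y"
      using convex_onD[OF convex, of ?\<theta> w y] by simp
    then have "A' * f w' \<le> A' * ((1 - ?\<theta>) * f w + ?\<theta> * f y)" using A'0 by simp
    also have "\<dots> = (1 - \<gamma>) * A * f w + \<gamma> * (A + a) * f y"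
      unfolding \<open>1 - ?\<theta> = _\<close> using A'0 by (simp add: distrib_left)
    finally show ?thesis .
  qed
  have "\<gamma> * A * (f y - f w) \<le> \<gamma> * A * (?G \<bullet> (y - w))"
    using above_tangent[of y w] A g by (intro mult_left_mono) (auto simp: inner_diff_right)
  moreover have "\<gamma> * a * (f y - f xs) \<le> \<gamma> * a * (?G \<bullet> (y - xs))"
    using above_tangent[of y xs] a0 g by (intro mult_left_mono) (auto simp: inner_diff_right)
  moreover have "\<gamma> * A * (?G \<bullet> (y - w)) + \<gamma> * a * (?G \<bullet> (y - xs))
      = \<gamma> * (A + a) * (?G \<bullet> (y - v)) + \<gamma> * a * (?G \<bullet> (z - xs))"
  proof -
    have "?G \<bullet> ((A + a) *\<^sub>R v) = ?G \<bullet> (A *\<^sub>R w + a *\<^sub>R z)" using Av by simp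
    then have "(A + a) * (?G \<bullet> v) = A * (?G \<bullet> w) + a * (?G \<bullet> z)" by (simp add: inner_add_right)
    then have "\<gamma> * ((A + a) * (?G \<bullet> v)) = \<gamma> * (A * (?G \<bullet> w) + a * (?G \<bullet> z))" by simp
    then show ?thesis by (simp add: inner_diff_right algebra_simps)
  qed
  ultimately have d1: "A' * (f w' - f xs) - A * (f w - f xs)
      \<le> \<gamma> * (A + a) * (?G \<bullet> (y - v)) + \<gamma> * a * (?G \<bullet> (z - xs))"
    using fw unfolding A' by (simp add: algebra_simps)
  have d2: "(norm (z' - xs))\<^sup>2 = (norm (z - xs))\<^sup>2 - 2 * (\<gamma> * a) * (?G \<bullet> (z - xs)) + (\<gamma> * a)\<^sup>2 * (norm ?G)\<^sup>2"
  proof -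
    have "z' - xs = (z - xs) - (\<gamma> * a) *\<^sub>R ?G" unfolding z' by simp
    then show ?thesis
      by (simp only: power2_norm_eq_inner)
        (simp only: inner_diff inner_scaleR_left inner_scaleR_right, simp add: inner_commute algebra_simps power2_eq_square)
  qed
  have ga: "(\<gamma> * a)\<^sup>2 = \<gamma> * ((A + a) / \<tau>)"
    unfolding quad[symmetric] \<gamma> using \<tau> by (simp add: power2_eq_square)
  have d3: "\<gamma> * (A + a) * (?G \<bullet> (y - v)) + (\<gamma> * a)\<^sup>2 * (norm ?G)\<^sup>2 / 2
      \<le> - (3 / 8) * ((A + a) * \<eta> * ?r\<^sup>2)"
  proof -
    have "(\<gamma> * a)\<^sup>2 * (norm ?G)\<^sup>2 / 2 = \<gamma> * (A + a) * ((norm ?G)\<^sup>2 / (2 * \<tau>))"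
      unfolding ga by simp
    then have "\<gamma> * (A + a) * (?G \<bullet> (y - v)) + (\<gamma> * a)\<^sup>2 * (norm ?G)\<^sup>2 / 2
        = \<gamma> * (A + a) * (?G \<bullet> (y - v) + (norm ?G)\<^sup>2 / (2 * \<tau>))"
      by (simp only: distrib_left)
    also have "\<dots> \<le> \<gamma> * (A + a) * (- (3 / 8) * \<tau> * ?r\<^sup>2)"
      using A a0 g by (intro mult_left_mono ms_certificate[OF \<tau> ms]) auto
    also have "\<dots> = - (3 / 8) * ((A + a) * \<eta> * ?r\<^sup>2)"
      unfolding g(3)[symmetric] by simp
    finally show ?thesis .
  qed
  have en': "energy w' z' A' + 3 / 8 * (S + (A + a) * \<eta> * ?r\<^sup>2) \<le> R\<^sup>2 / 2"
    using d1 d2 d3 en unfolding energy_def distrib_left by linarith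
  \<comment> \<open>Unlike in the definition of the new point, \<open>w\<close> enters here free of damping.\<close>
  have Aw: "A' *\<^sub>R (w' - xs) = A *\<^sub>R (w - xs) + (\<gamma> * a) *\<^sub>R (z - xs) + (\<gamma> * (A + a)) *\<^sub>R (y - v)"
  proof -
    have "A' *\<^sub>R w' = ((1 - \<gamma>) * A) *\<^sub>R w + (\<gamma> * (A + a)) *\<^sub>R y" unfolding w' using A'0 by simp
    moreover have "(\<gamma> * (A + a)) *\<^sub>R v = \<gamma> *\<^sub>R (A *\<^sub>R w + a *\<^sub>R z)" using Av by (metis scaleR_scaleR)
    ultimately show ?thesis unfolding A' by (simp add: algebra_simps)
  qed
  have sq: "\<gamma> * (A + a) * ?r = sqrt ((\<gamma> * a)\<^sup>2) * sqrt ((A + a) * \<eta> * ?r\<^sup>2)"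
  proof -
    have "(A + a) * \<eta> * ?r\<^sup>2 = (\<eta> * a * ?r)\<^sup>2"
      unfolding quad[symmetric] by (simp add: power2_eq_square)
    then have "sqrt ((A + a) * \<eta> * ?r\<^sup>2) = \<eta> * a * ?r" using a0 \<eta> by simp
    then show ?thesis unfolding quad[symmetric] using a0 g by (simp add: power2_eq_square)
  qed
  have "norm (A' *\<^sub>R (w' - xs)) \<le> norm (A *\<^sub>R (w - xs)) + norm ((\<gamma> * a) *\<^sub>R (z - xs)) + norm ((\<gamma> * (A + a)) *\<^sub>R (y - v))"
    unfolding Aw by (meson add_right_mono norm_triangle_ineq order_trans)
  also have "norm ((\<gamma> * a) *\<^sub>R (z - xs)) \<le> \<gamma> * a * R"
    using tracked_z[OF t R] a0 g by simp
  also have "norm ((\<gamma> * (A + a)) *\<^sub>R (y - v)) = sqrt ((\<gamma> * a)\<^sup>2) * sqrt ((A + a) * \<eta> * ?r\<^sup>2)"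
    unfolding sq[symmetric] using A a0 g by simp
  finally have nw': "norm (A' *\<^sub>R (w' - xs)) \<le> A' * R +
      (sqrt Q * sqrt S + sqrt ((\<gamma> * a)\<^sup>2) * sqrt ((A + a) * \<eta> * ?r\<^sup>2))"
    using nw unfolding A' distrib_right by linarith
  have "0 \<le> (A + a) * \<eta> * ?r\<^sup>2" using A a0 \<eta> by simp
  then have "sqrt Q * sqrt S + sqrt ((\<gamma> * a)\<^sup>2) * sqrt ((A + a) * \<eta> * ?r\<^sup>2)
      \<le> sqrt (Q + (\<gamma> * a)\<^sup>2) * sqrt (S + (A + a) * \<eta> * ?r\<^sup>2)"
    using A by (intro sqrt_Cauchy_two) auto
  with nw' have nw'': "norm (A' *\<^sub>R (w' - xs)) \<le> A' * R + sqrt (Q + (\<gamma> * a)\<^sup>2) * sqrt (S + (A + a) * \<eta> * ?r\<^sup>2)"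
    by linarith
  have "Q + (\<gamma> * a)\<^sup>2 \<le> A'\<^sup>2"
  proof -
    have "0 \<le> A * (\<gamma> * a)" using A a0 g by simp
    then show ?thesis using A(4) unfolding A' by (simp add: power2_sum)
  qed
  then show ?thesis
    unfolding tracked_def using A'0 en' nw'' A a0 \<eta> by simp
qed

end

section \<open>Power and logarithm inequalities\<close>

lemma powr_Young:
  fixes a b \<theta> :: real
  assumes "0 \<le> a" "0 \<le> b" "0 \<le> \<theta>" "\<theta> \<le> 1"
  shows "a powr \<theta> * b powr (1 - \<theta>) \<le> \<theta> * a + (1 - \<theta>) * b"
proof (cases "a = 0 \<or> b = 0")
  case False
  then show ?thesis using assms Youngs_inequality_0[of \<theta> "1 - \<theta>" a b] by simp
qed (use assms in auto)

text \<open>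
  Superadditivity of the weighted geometric mean: Hoelder's inequality for two summands.
  Applied once per iteration it yields Hoelder's inequality for the whole run.
\<close>

lemma powr_Holder_two:
  fixes a b c d \<theta> :: real
  assumes "0 \<le> a" "0 \<le> b" "0 \<le> c" "0 \<le> d" "0 \<le> \<theta>" "\<theta> \<le> 1"
  shows "a powr \<theta> * b powr (1 - \<theta>) + c powr \<theta> * d powr (1 - \<theta>) \<le> (a + c) powr \<theta> * (b + d) powr (1 - \<theta>)"
proof (cases "a + c = 0 \<or> b + d = 0")
  case True
  then have "(a = 0 \<and> c = 0) \<or> (b = 0 \<and> d = 0)" using assms by auto
  then show ?thesis by auto
next
  case False
  let ?p = "a + c" and ?q = "b + d"
  have pq: "?p > 0" "?q > 0" using False assms by auto
  have scale: "x powr \<theta> * y powr (1 - \<theta>) = ?p powr \<theta> * ?q powr (1 - \<theta>) * ((x / ?p) powr \<theta> * (y / ?q) powr (1 - \<theta>))"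
    if "0 \<le> x" "0 \<le> y" for x y
  proof -
    have "x powr \<theta> = ?p powr \<theta> * (x / ?p) powr \<theta>" "y powr (1 - \<theta>) = ?q powr (1 - \<theta>) * (y / ?q) powr (1 - \<theta>)"
      using pq that by (simp_all flip: powr_mult)
    then show ?thesis by simp
  qed
  have split: "(\<theta> * (a / u) + (1 - \<theta>) * (b / w)) + (\<theta> * (c / u) + (1 - \<theta>) * (d / w))
      = \<theta> * ((a + c) / u) + (1 - \<theta>) * ((b + d) / w)" for u w
    by (simp add: add_divide_distrib algebra_simps)
  have "(a / ?p) powr \<theta> * (b / ?q) powr (1 - \<theta>) + (c / ?p) powr \<theta> * (d / ?q) powr (1 - \<theta>)
     \<le> (\<theta> * (a / ?p) + (1 - \<theta>) * (b / ?q)) + (\<theta> * (c / ?p) + (1 - \<theta>) * (d / ?q))"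
    using assms pq by (intro add_mono powr_Young) auto
  also have "\<dots> = \<theta> * ((a + c) / ?p) + (1 - \<theta>) * ((b + d) / ?q)"
    by (rule split)
  also have "\<dots> = 1" using pq by simp
  finally have le: "(a / ?p) powr \<theta> * (b / ?q) powr (1 - \<theta>) + (c / ?p) powr \<theta> * (d / ?q) powr (1 - \<theta>) \<le> 1" .
  have "?p powr \<theta> * ?q powr (1 - \<theta>) * ((a / ?p) powr \<theta> * (b / ?q) powr (1 - \<theta>) + (c / ?p) powr \<theta> * (d / ?q) powr (1 - \<theta>))
      \<le> ?p powr \<theta> * ?q powr (1 - \<theta>) * 1"
    by (intro mult_left_mono le) simp
  then show ?thesis
    using scale[of a b] scale[of c d] assms by (simp add: distrib_left)
qed

lemma log2_le_sqrt:
  assumes "0 < x" shows "log 2 x \<le> 3 * sqrt x"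
proof -
  have "ln x = 2 * ln (sqrt x)" using assms by (simp add: ln_sqrt)
  also have "\<dots> \<le> 2 * sqrt x" using assms ln_le_minus_one[of "sqrt x"] by simp
  also have "\<dots> \<le> ln 2 * (3 * sqrt x)"
    using mult_right_mono[OF ln2_ge_two_thirds, of "3 * sqrt x"] assms by simp
  finally show ?thesis unfolding log_def by (simp add: field_simps)
qed

lemma log2_le_powr:
  assumes "0 < x" shows "log 2 x \<le> 21 / 4 * x powr (2 / 7)"
proof -
  have "ln x = 7 / 2 * ln (x powr (2 / 7))" using assms by (simp add: ln_powr)
  also have "\<dots> \<le> 7 / 2 * x powr (2 / 7)" using assms ln_le_minus_one[of "x powr (2 / 7)"] by simp
  also have "\<dots> \<le> ln 2 * (21 / 4 * x powr (2 / 7))"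
    using mult_right_mono[OF ln2_ge_two_thirds, of "21 / 4 * x powr (2 / 7)"] by simp
  finally show ?thesis unfolding log_def by (simp add: field_simps)
qed

text \<open>
  Reduces numerical bounds on fractional powers to comparisons of integer powers.
\<close>

lemma powr_le_of_power:
  fixes x c :: real
  assumes "0 \<le> x" "0 \<le> c" "x ^ a \<le> c ^ b" "b > 0" "a > 0"
  shows "x powr (real a / real b) \<le> c"
proof (cases "x = 0")
  case False
  then have "x > 0" using assms by simp
  then have "(x powr (real a / real b)) ^ b = x ^ a"
    using assms by (simp add: powr_powr flip: powr_realpow)
  then show ?thesis using assms by (metis power_le_imp_le_base powr_ge_zero power_mono_iff)
qed (use assms in simp)

section \<open>Bookkeeping of up-steps and down-steps\<close>

text \<open>
  The bookkeeping of a run. Over the up-steps so far, \<open>V\<close> bounds the sum of \<open>A \<eta> q\<^sup>2\<close>, and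
  \<open>D\<close>, \<open>W\<close>, \<open>Y\<close> are the sums of \<open>\<eta>\<^sup>-\<^sup>1\<^sup>/\<^sup>2\<close>, \<open>(A \<eta>)\<^sup>-\<^sup>1\<^sup>/\<^sup>2\<close> and \<open>(q/\<eta>)\<^sup>2\<^sup>/\<^sup>7\<close>; \<open>G\<close> counts
  those with \<open>\<kappa> q > 1\<close>, where \<open>\<kappa> = 1/r0\<close>. The initial parameter is \<open>\<eta>1\<close>. The summand
  \<open>7/2 / \<surd>\<eta>\<close> next to \<open>D\<close> is the potential of the matching: a doubling of \<open>\<eta>\<close> releases enough
  of it to pay for \<open>\<eta>\<^sup>-\<^sup>1\<^sup>/\<^sup>2\<close>, since \<open>7/2 (1 - 1/\<surd>2) \<ge> 1\<close>, and a halving needs no more than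
  the growth of \<open>7/2 \<surd>A\<close>, since \<open>\<surd>2 - 1 \<le> 1/2\<close>. Before the first up-step \<open>D = 0\<close>, so the
  logarithm in the bound for \<open>W\<close> needs a separate case.
\<close>

definition ledger :: "real \<Rightarrow> real \<Rightarrow> real \<Rightarrow> real \<Rightarrow> real \<Rightarrow> real \<Rightarrow> real \<Rightarrow> real \<Rightarrow> real \<Rightarrow> real \<Rightarrow> bool" where
  "ledger \<kappa> T \<eta>1 V D W Y G A \<eta> \<longleftrightarrow>
    A > 0 \<and> \<eta> > 0 \<and> 0 \<le> V \<and> 0 \<le> D \<and> 0 \<le> W \<and>
    D + 7 / 2 / sqrt \<eta> \<le> 7 / 2 * sqrt A \<and> D \<le> 7 / 2 * sqrt T \<and>
    (D = 0 \<and> W = 0 \<and> \<eta> \<le> \<eta>1 \<or> 1 \<le> D * sqrt \<eta>1 \<and> W \<le> 7 / 2 * (1 + ln (D * sqrt \<eta>1))) \<and>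
    Y \<le> 9 / 4 * (V powr (1 / 7) * D powr (4 / 7)) \<and>
    G \<le> (\<kappa>\<^sup>2 * V) powr (1 / 3) * W powr (2 / 3)"

lemma ledger_init:
  assumes "\<eta>1 > 0" "0 \<le> V" "0 \<le> T"
  shows "ledger \<kappa> T \<eta>1 V 0 0 0 0 (1 / \<eta>1) \<eta>1"
  using assms unfolding ledger_def by (simp add: real_sqrt_divide)

lemma ledger_down:
  assumes l: "ledger \<kappa> T \<eta>1 V D W Y G A \<eta>" and "V \<le> V'"
    and A': "sqrt A + 1 / (2 * sqrt \<eta>) \<le> sqrt A'"
  shows "ledger \<kappa> T \<eta>1 V' D W Y G A' (\<eta> / 2)"
proof -
  note l' = l[unfolded ledger_def]
  have pos: "\<eta> > 0" "A > 0" "0 \<le> V" "0 \<le> D" using l' by auto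
  have s2: "sqrt 2 \<le> 3 / 2" by (rule real_le_lsqrt) (simp_all add: power2_eq_square)
  have "7 / 2 / sqrt (\<eta> / 2) = 7 / 2 * sqrt 2 * (1 / sqrt \<eta>)" by (simp add: real_sqrt_divide)
  also have "\<dots> \<le> 7 / 2 * (3 / 2) * (1 / sqrt \<eta>)"
    using pos s2 by (intro mult_right_mono mult_left_mono) auto
  finally have "7 / 2 / sqrt (\<eta> / 2) \<le> 7 / 2 / sqrt \<eta> + 7 / 2 * (1 / (2 * sqrt \<eta>))" by simp
  moreover have "7 / 2 * sqrt A + 7 / 2 * (1 / (2 * sqrt \<eta>)) \<le> 7 / 2 * sqrt A'" using A' by simp
  ultimately have "D + 7 / 2 / sqrt (\<eta> / 2) \<le> 7 / 2 * sqrt A'" using l' by linarith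
  moreover have "A' > 0"
  proof -
    have "0 < sqrt A + 1 / (2 * sqrt \<eta>)" using pos by (intro add_pos_pos) auto
    then show ?thesis using A' by (metis less_le_trans real_sqrt_gt_0_iff)
  qed
  moreover have "9 / 4 * (V powr (1 / 7) * D powr (4 / 7)) \<le> 9 / 4 * (V' powr (1 / 7) * D powr (4 / 7))"
    using pos assms(2) by (intro mult_left_mono mult_right_mono powr_mono2) auto
  moreover have "(\<kappa>\<^sup>2 * V) powr (1 / 3) * W powr (2 / 3) \<le> (\<kappa>\<^sup>2 * V') powr (1 / 3) * W powr (2 / 3)"
    using pos assms(2) by (intro mult_right_mono powr_mono2 mult_left_mono) auto
  moreover have "\<eta> / 2 \<le> \<eta>1" if "\<eta> \<le> \<eta>1" using that pos by simp
  ultimately show ?thesis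
    using l' assms(2) unfolding ledger_def by (smt (verit) half_gt_zero)
qed

text \<open>
  Concavity of \<open>x \<mapsto> x\<^sup>2\<^sup>/\<^sup>3\<close>, written for the cube roots \<open>p0\<close> and \<open>p\<close> so that it is
  polynomial: \<open>p\<^sup>3 - 3 p p0\<^sup>2 + 2 p0\<^sup>3 = (p - p0)\<^sup>2 (p + 2 p0)\<close>.
\<close>

lemma two_thirds_power_increment:
  fixes p0 p :: real
  assumes "0 \<le> p0" "p0 \<le> p" "0 < p"
  shows "2 / 3 * (p ^ 3 - p0 ^ 3) / p \<le> p\<^sup>2 - p0\<^sup>2"
proof -
  have "0 \<le> (p - p0)\<^sup>2 * (p + 2 * p0)" using assms by simp
  then have "2 * (p ^ 3 - p0 ^ 3) \<le> 3 * (p\<^sup>2 - p0\<^sup>2) * p"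
    by (simp add: power2_eq_square power3_eq_cube algebra_simps)
  then show ?thesis using assms by (simp add: field_simps)
qed

text \<open>
  Since \<open>D' = D + \<eta>\<^sup>-\<^sup>1\<^sup>/\<^sup>2 \<le> 7/2 \<surd>A\<close>, the weight \<open>A\<close> can be replaced by \<open>(2/7 D')\<^sup>2\<close>. The new
  summands of \<open>W\<close> and \<open>Y\<close> then become increments of \<open>ln D\<close> and, after the Hoelder step with
  exponents 1/7 and 6/7, of \<open>D\<^sup>2\<^sup>/\<^sup>3\<close>. For \<open>G\<close> the exponents are 1/3 and 2/3, as
  \<open>(A \<eta> q\<^sup>2) (A \<eta>)\<^sup>-\<^sup>1 = q\<^sup>2\<close>.
\<close>

lemma ledger_up:
  assumes l: "ledger \<kappa> T \<eta>1 V D W Y G A \<eta>" and "A < T" and "A \<le> A'" and "0 \<le> \<kappa>" "0 \<le> q"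
    and v: "A * \<eta> * q\<^sup>2 \<le> v"
  shows "ledger \<kappa> T \<eta>1 (V + v) (D + 1 / sqrt \<eta>) (W + 1 / sqrt (A * \<eta>)) (Y + (q / \<eta>) powr (2 / 7))
    (G + (if 1 < \<kappa> * q then 1 else 0)) A' (2 * \<eta>)"
proof -
  note l' = l[unfolded ledger_def]
  have pos: "\<eta> > 0" "A > 0" "0 \<le> V" "0 \<le> D" "0 \<le> W" using l' by auto
  have v0: "0 \<le> v" using v pos by (meson mult_nonneg_nonneg less_imp_le order_trans zero_le_power2)
  define d where "d = 1 / sqrt \<eta>"
  have d: "d > 0" "7 / 2 / sqrt \<eta> = 7 / 2 * d" unfolding d_def using pos by auto
  define D' where "D' = D + d"
  define w where "w = 1 / sqrt (A * \<eta>)"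
  have D': "D' > 0" "D < D'" using d pos unfolding D'_def by auto
  have D'A: "D' \<le> 7 / 2 * sqrt A" using l' d unfolding D'_def by linarith
  have matching: "D' + 7 / 2 / sqrt (2 * \<eta>) \<le> 7 / 2 * sqrt A'"
  proof -
    have "7 / 5 \<le> sqrt 2" by (rule real_le_rsqrt) (simp add: power2_eq_square)
    then have "1 / sqrt 2 \<le> 5 / 7" by (simp add: field_simps)
    then have "7 / 2 * d * (1 / sqrt 2) \<le> 7 / 2 * d * (5 / 7)"
      using d by (intro mult_left_mono) auto
    moreover have "7 / 2 / sqrt (2 * \<eta>) = 7 / 2 * d * (1 / sqrt 2)"
      unfolding d_def by (simp add: real_sqrt_mult)
    moreover have "sqrt A \<le> sqrt A'" using assms by simp
    ultimately show ?thesis using l' d unfolding D'_def by linarith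
  qed
  have D'T: "D' \<le> 7 / 2 * sqrt T"
  proof -
    have "sqrt A \<le> sqrt T" using assms by simp
    then show ?thesis using D'A by linarith
  qed
  have w: "0 < w" "w \<le> 7 / 2 * (d / D')"
  proof -
    show "0 < w" unfolding w_def using pos by simp
    have "w = d / sqrt A" unfolding w_def d_def by (simp add: real_sqrt_mult)
    also have "\<dots> \<le> d / (D' * (2 / 7))"
      using D'A D' d by (intro divide_left_mono) (auto intro!: mult_pos_pos simp: pos)
    finally show "w \<le> 7 / 2 * (d / D')" by simp
  qed
  have W': "1 \<le> D' * sqrt \<eta>1 \<and> W + w \<le> 7 / 2 * (1 + ln (D' * sqrt \<eta>1))"
  proof -
    consider "D = 0" "W = 0" "\<eta> \<le> \<eta>1" | "1 \<le> D * sqrt \<eta>1" "W \<le> 7 / 2 * (1 + ln (D * sqrt \<eta>1))"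
      using l' by blast
    then show ?thesis
    proof cases
      case 1
      then have ge: "1 \<le> D' * sqrt \<eta>1" unfolding D'_def d_def using pos by (simp add: field_simps)
      have "w \<le> 7 / 2" using w(2) 1 d unfolding D'_def by simp
      also have "\<dots> \<le> 7 / 2 * (1 + ln (D' * sqrt \<eta>1))" using ge by simp
      finally have "w \<le> 7 / 2 * (1 + ln (D' * sqrt \<eta>1))" .
      then show ?thesis using 1 ge by simp
    next
      case 2
      then have Dp: "0 < D * sqrt \<eta>1" by linarith
      then have "D > 0" "sqrt \<eta>1 > 0" using pos by (auto simp: zero_less_mult_iff)
      have "1 \<le> D' * sqrt \<eta>1"
        using 2(1) mult_right_mono[of D D' "sqrt \<eta>1"] D' \<open>sqrt \<eta>1 > 0\<close> by linarith
      moreover have "d / D' \<le> ln (D' * sqrt \<eta>1) - ln (D * sqrt \<eta>1)"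
      proof -
        have "ln (D / D') \<le> D / D' - 1" using \<open>D > 0\<close> D' by (intro ln_le_minus_one) simp
        moreover have "D / D' - 1 = - (d / D')" using D' unfolding D'_def by (simp add: field_simps)
        moreover have "ln (D / D') = ln D - ln D'" using \<open>D > 0\<close> D' by (simp add: ln_div)
        ultimately show ?thesis using \<open>D > 0\<close> D' \<open>sqrt \<eta>1 > 0\<close> by (simp add: ln_mult)
      qed
      moreover from this have "W + w \<le> 7 / 2 * (1 + ln (D' * sqrt \<eta>1))"
        using 2(2) w(2) by argo
      ultimately show ?thesis by blast
    qed
  qed
  have Y': "Y + (q / \<eta>) powr (2 / 7) \<le> 9 / 4 * ((V + v) powr (1 / 7) * D' powr (4 / 7))"
  proof -
    define p where "p = D' powr (1 / 3)"
    define p0 where "p0 = D powr (1 / 3)"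
    have p: "p > 0" "0 \<le> p0" "p0 \<le> p" unfolding p_def p0_def using D' pos
      by (auto intro!: powr_mono2)
    have p3: "p ^ 3 = D'" "p0 ^ 3 = D"
      unfolding p_def p0_def using D' pos by (simp_all add: powr_power powr_powr flip: powr_numeral)
    have p4: "(p\<^sup>2) powr (6 / 7) = D' powr (4 / 7)" "(p0\<^sup>2) powr (6 / 7) = D powr (4 / 7)"
      unfolding p_def p0_def using D' pos by (simp_all add: powr_powr flip: powr_numeral)
    define \<Delta> where "\<Delta> = p\<^sup>2 - p0\<^sup>2"
    have "2 / 3 * (D' - D) / p \<le> \<Delta>"
      using two_thirds_power_increment[of p0 p] p p3 unfolding \<Delta>_def by simp
    then have \<Delta>: "2 / 3 * d / p \<le> \<Delta>" unfolding D'_def by simp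
    have \<Delta>0: "0 \<le> \<Delta>" unfolding \<Delta>_def using p by (simp add: power_mono)
    have eta: "\<eta> * d\<^sup>2 = 1" unfolding d_def using pos by (simp add: power_divide)
    have "q / \<eta> = q * d\<^sup>2" using eta pos by (simp add: field_simps)
    then have q: "(q / \<eta>)\<^sup>2 = q\<^sup>2 * d ^ 4" by (simp add: power_mult_distrib)
    define K :: real where "K = (9 / 4) ^ 7"
    \<comment> \<open>The constant 9/4 in the ledger is chosen for this inequality.\<close>
    have K: "1 \<le> K * (4 / 49 * (2 / 3) ^ 6)" unfolding K_def by (simp add: power_divide)
    have "0 \<le> q\<^sup>2 * d ^ 4" by simp
    from mult_right_mono[OF K this]
    have e1: "q\<^sup>2 * d ^ 4 \<le> K * (4 / 49 * (2 / 3) ^ 6) * (q\<^sup>2 * d ^ 4)" unfolding mult_1_left .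
    have d4: "d ^ 4 = \<eta> * d ^ 6"
    proof -
      have "d ^ 6 = d\<^sup>2 * d ^ 4" by (subst power_add[symmetric]) simp
      then have "\<eta> * d ^ 6 = (\<eta> * d\<^sup>2) * d ^ 4" by (simp only: mult.assoc)
      then show ?thesis unfolding eta by simp
    qed
    have e2: "K * (4 / 49 * (2 / 3) ^ 6) * (q\<^sup>2 * d ^ 4)
        = K * ((4 / 49 * D'\<^sup>2 * \<eta> * q\<^sup>2) * (2 / 3 * d / p) ^ 6)"
    proof -
      have "D'\<^sup>2 = p ^ 6" unfolding p3(1)[symmetric] by (simp flip: power_mult)
      moreover have "(2 / 3 * d / p) ^ 6 = (2 / 3) ^ 6 * d ^ 6 / p ^ 6"
        by (simp only: power_mult_distrib power_divide)
      ultimately show ?thesis unfolding d4 using p(1) by simp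
    qed
    have e3: "K * ((4 / 49 * D'\<^sup>2 * \<eta> * q\<^sup>2) * (2 / 3 * d / p) ^ 6) \<le> K * (v * \<Delta> ^ 6)"
    proof (rule mult_left_mono[OF mult_mono[OF _ power_mono[OF \<Delta>]]])
      have "D'\<^sup>2 \<le> (7 / 2 * sqrt A)\<^sup>2" using D' D'A by (intro power_mono) auto
      then have "4 / 49 * D'\<^sup>2 \<le> A" using pos by (simp add: power_mult_distrib power_divide)
      then have "4 / 49 * D'\<^sup>2 * (\<eta> * q\<^sup>2) \<le> A * (\<eta> * q\<^sup>2)"
        using pos by (intro mult_right_mono) auto
      then show "4 / 49 * D'\<^sup>2 * \<eta> * q\<^sup>2 \<le> v" using v by (simp add: mult.assoc)
    qed (use d p v0 in \<open>auto simp: K_def\<close>)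
    have le: "(q / \<eta>)\<^sup>2 \<le> (9 / 4) ^ 7 * (v * \<Delta> ^ 6)"
      unfolding q K_def[symmetric] by (rule order_trans[OF e1[unfolded e2] e3])
    have "(q / \<eta>) powr (2 / 7) \<le> 9 / 4 * (v powr (1 / 7) * \<Delta> powr (6 / 7))"
    proof -
      have "(q / \<eta>) powr (2 / 7) = ((q / \<eta>)\<^sup>2) powr (1 / 7)"
        using pos assms by (simp add: powr_powr flip: powr_numeral)
      also have "\<dots> \<le> ((9 / 4) ^ 7 * (v * \<Delta> ^ 6)) powr (1 / 7)"
        using le by (intro powr_mono2) auto
      also have "\<dots> = ((9 / 4) ^ 7) powr (1 / 7) * (v powr (1 / 7) * (\<Delta> ^ 6) powr (1 / 7))"
        using v0 \<Delta>0 by (simp only: powr_mult mult_nonneg_nonneg zero_le_power)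
      also have "((9 / 4 :: real) ^ 7) powr (1 / 7) = 9 / 4"
      proof -
        have "((9 / 4 :: real) ^ 7) powr (1 / 7) = ((9 / 4) powr 7) powr (1 / 7)"
          by (subst powr_numeral) auto
        then show ?thesis by (simp only: powr_powr) simp
      qed
      also have "(\<Delta> ^ 6) powr (1 / 7) = \<Delta> powr (6 / 7)"
      proof -
        have "(\<Delta> ^ 6) powr (1 / 7) = (\<Delta> powr 6) powr (1 / 7)"
          by (subst powr_numeral) (use \<Delta>0 in auto)
        then show ?thesis by (simp only: powr_powr) simp
      qed
      finally show ?thesis .
    qed
    then have "Y + (q / \<eta>) powr (2 / 7)
        \<le> 9 / 4 * (V powr (1 / 7) * (p0\<^sup>2) powr (6 / 7) + v powr (1 / 7) * \<Delta> powr (6 / 7))"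
      using l' p4 by simp
    also have "\<dots> \<le> 9 / 4 * ((V + v) powr (1 / 7) * (p0\<^sup>2 + \<Delta>) powr (6 / 7))"
      using powr_Holder_two[of V "p0\<^sup>2" v \<Delta> "1 / 7"] pos v0 \<Delta>0 by simp
    also have "p0\<^sup>2 + \<Delta> = p\<^sup>2" unfolding \<Delta>_def by simp
    finally show ?thesis using p4 by simp
  qed
  have G': "G + (if 1 < \<kappa> * q then 1 else 0) \<le> (\<kappa>\<^sup>2 * (V + v)) powr (1 / 3) * (W + w) powr (2 / 3)"
  proof -
    have "(if 1 < \<kappa> * q then 1 else 0) \<le> (\<kappa>\<^sup>2 * v) powr (1 / 3) * w powr (2 / 3)"
    proof (cases "1 < \<kappa> * q")
      case True
      have "w\<^sup>2 * (A * \<eta>) = 1" unfolding w_def using pos by (simp add: power_divide)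
      then have "(\<kappa> * q)\<^sup>2 = \<kappa>\<^sup>2 * (A * \<eta> * q\<^sup>2) * w\<^sup>2" by (simp add: power_mult_distrib algebra_simps)
      also have "\<dots> \<le> \<kappa>\<^sup>2 * v * w\<^sup>2" by (intro mult_right_mono mult_left_mono v) auto
      finally have "1 \<le> \<kappa>\<^sup>2 * v * w\<^sup>2" using True by (smt (verit) one_le_power)
      then have "1 \<le> (\<kappa>\<^sup>2 * v * w\<^sup>2) powr (1 / 3)" by (intro ge_one_powr_ge_zero) auto
      also have "\<dots> = (\<kappa>\<^sup>2 * v) powr (1 / 3) * w powr (2 / 3)"
        using w v0 by (simp add: powr_mult powr_powr flip: powr_numeral)
      finally show ?thesis using True by simp
    qed simp
    then have "G + (if 1 < \<kappa> * q then 1 else 0)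
        \<le> (\<kappa>\<^sup>2 * V) powr (1 / 3) * W powr (2 / 3) + (\<kappa>\<^sup>2 * v) powr (1 / 3) * w powr (2 / 3)"
      using l' by linarith
    also have "\<dots> \<le> (\<kappa>\<^sup>2 * V + \<kappa>\<^sup>2 * v) powr (1 / 3) * (W + w) powr (2 / 3)"
      using powr_Holder_two[of "\<kappa>\<^sup>2 * V" W "\<kappa>\<^sup>2 * v" w "1 / 3"] pos v0 w by simp
    finally show ?thesis by (simp add: distrib_left)
  qed
  show ?thesis
    unfolding ledger_def d_def[symmetric] D'_def[symmetric] w_def[symmetric]
    using matching D'T W' Y' G' pos v0 w D' assms by (auto simp del: divide_const_simps)
qed

lemma ledger_Y_bound:
  assumes l: "ledger \<kappa> T \<eta>1 V D W Y G A \<eta>" and V: "V \<le> 8 / 3 * R\<^sup>2" and "0 \<le> R" "0 \<le> T"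
  shows "Y \<le> 27 / 5 * (R * T) powr (2 / 7)"
proof -
  note l' = l[unfolded ledger_def]
  have "V powr (1 / 7) * D powr (4 / 7) \<le> (8 / 3 * R\<^sup>2) powr (1 / 7) * (7 / 2 * sqrt T) powr (4 / 7)"
    using l' V by (intro mult_mono powr_mono2) auto
  also have "(7 / 2 * sqrt T) powr (4 / 7) = ((7 / 2) ^ 4 * T\<^sup>2) powr (1 / 7)"
  proof -
    have "(7 / 2 * sqrt T) powr (4 / 7) = ((7 / 2 * sqrt T) powr 4) powr (1 / 7)"
      by (simp only: powr_powr) simp
    also have "(7 / 2 * sqrt T) powr 4 = (7 / 2 * sqrt T) ^ 4"
      by (subst powr_numeral) (use assms in auto)
    also have "\<dots> = (7 / 2) ^ 4 * T\<^sup>2"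
      using assms power_mult[of "sqrt T" 2 2] by (simp add: power_mult_distrib power_divide)
    finally show ?thesis .
  qed
  also have "(8 / 3 * R\<^sup>2) powr (1 / 7) * ((7 / 2) ^ 4 * T\<^sup>2) powr (1 / 7) = (8 / 3 * (7 / 2) ^ 4 * (R * T)\<^sup>2) powr (1 / 7)"
    by (subst powr_mult[symmetric]) (auto simp: power_mult_distrib mult_ac)
  also have "\<dots> \<le> ((12 / 5) ^ 7 * (R * T)\<^sup>2) powr (1 / 7)"
    by (intro powr_mono2 mult_right_mono) (auto simp: power_divide)
  also have "\<dots> = ((12 / 5) ^ 7) powr (1 / 7) * ((R * T)\<^sup>2) powr (1 / 7)"
    by (intro powr_mult)
  also have "((12 / 5 :: real) ^ 7) powr (1 / 7) = 12 / 5"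
  proof -
    have "((12 / 5 :: real) ^ 7) powr (1 / 7) = ((12 / 5) powr 7) powr (1 / 7)"
      by (subst powr_numeral) auto
    then show ?thesis by (simp only: powr_powr) simp
  qed
  also have "((R * T)\<^sup>2) powr (1 / 7) = (R * T) powr (2 / 7)"
    using assms by (simp add: powr_powr flip: powr_numeral)
  finally show ?thesis using l' by simp
qed

lemma ledger_G_bound:
  assumes l: "ledger \<kappa> T \<eta>1 V D W Y G A \<eta>" and V: "V \<le> 8 / 3 * R\<^sup>2" and "0 \<le> R" "0 \<le> \<kappa>" "0 < T"
    and \<eta>1: "0 < \<eta>1" "\<eta>1 \<le> 2 * m"
  shows "G \<le> 5 * (\<kappa> * R) powr (2 / 3) * (1 + log_plus (8 * m * T)) powr (2 / 3)"
proof -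
  note l' = l[unfolded ledger_def]
  let ?l = "log_plus (8 * m * T)"
  have init_doublings: "?l \<ge> 0" unfolding log_plus_def by simp
  have mT: "8 * m * T > 0" using assms by simp
  have W: "W \<le> 49 / 8 * (1 + ?l)"
  proof (cases "D = 0 \<and> W = 0")
    case False
    then have D: "1 \<le> D * sqrt \<eta>1" "W \<le> 7 / 2 * (1 + ln (D * sqrt \<eta>1))" using l' by auto
    have "D * sqrt \<eta>1 \<le> 7 / 2 * sqrt T * sqrt (2 * m)"
      using l' \<eta>1 \<open>0 < T\<close> by (intro mult_mono) auto
    also have "\<dots> = 7 / 4 * sqrt (8 * m * T)"
    proof -
      have "8 * m * T = 2\<^sup>2 * (T * (2 * m))" by simp
      then have "sqrt (8 * m * T) = 2 * (sqrt T * sqrt (2 * m))"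
        by (simp only: real_sqrt_mult[of "2\<^sup>2"] real_sqrt_mult[of T] real_sqrt_abs)
      then show ?thesis by simp
    qed
    finally have "ln (D * sqrt \<eta>1) \<le> ln (7 / 4 * sqrt (8 * m * T))"
      by (meson D(1) ln_mono less_le_trans zero_less_one)
    also have "\<dots> = ln (7 / 4) + ln (8 * m * T) / 2" using mT by (subst ln_mult) (auto simp: ln_sqrt)
    also have "\<dots> \<le> 3 / 4 + ?l / 2"
      using ln_le_minus_one[of "7/4"] mT unfolding log_plus_def by simp
    finally show ?thesis using D init_doublings by simp
  qed (use init_doublings in auto)
  have "G \<le> (\<kappa>\<^sup>2 * V) powr (1 / 3) * W powr (2 / 3)" using l' by blast
  also have "\<dots> \<le> (8 / 3 * (\<kappa> * R)\<^sup>2) powr (1 / 3) * (49 / 8 * (1 + ?l)) powr (2 / 3)"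
  proof (rule mult_mono[OF powr_mono2 powr_mono2])
    show "\<kappa>\<^sup>2 * V \<le> 8 / 3 * (\<kappa> * R)\<^sup>2"
      using mult_left_mono[OF V, of "\<kappa>\<^sup>2"] by (simp add: power_mult_distrib mult_ac)
  qed (use l' W in auto)
  also have "(49 / 8 * (1 + ?l)) powr (2 / 3) = ((49 / 8)\<^sup>2) powr (1 / 3) * (1 + ?l) powr (2 / 3)"
    using init_doublings by (subst powr_mult) (auto simp: powr_powr simp flip: powr_numeral)
  also have "(8 / 3 * (\<kappa> * R)\<^sup>2) powr (1 / 3) = (8 / 3) powr (1 / 3) * (\<kappa> * R) powr (2 / 3)"
    using assms by (subst powr_mult) (auto simp: powr_powr simp flip: powr_numeral)
  also have "(8 / 3) powr (1 / 3) * (\<kappa> * R) powr (2 / 3) * (((49 / 8)\<^sup>2) powr (1 / 3) * (1 + ?l) powr (2 / 3))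
     = (8 / 3 * (49 / 8)\<^sup>2) powr (1 / 3) * ((\<kappa> * R) powr (2 / 3) * (1 + ?l) powr (2 / 3))"
    by (subst powr_mult) auto
  also have "\<dots> \<le> 5 * ((\<kappa> * R) powr (2 / 3) * (1 + ?l) powr (2 / 3))"
    using powr_le_of_power[of "8 / 3 * (49 / 8)\<^sup>2" 5 1 3]
    by (intro mult_right_mono) (auto simp: power2_eq_square)
  finally show ?thesis by simp
qed

section \<open>The cost of a call\<close>

lemma log2_le_delta_term:
  assumes "0 < X" "X \<le> 16 * \<delta>" "0 < \<eta>"
  shows "log 2 (X / \<eta>) \<le> 12 * sqrt \<delta> * (1 / sqrt \<eta>)"
proof -
  have "log 2 (X / \<eta>) \<le> 3 * sqrt (X / \<eta>)" using assms by (intro log2_le_sqrt) simp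
  also have "sqrt (X / \<eta>) \<le> sqrt (16 * \<delta> / \<eta>)"
    using assms by (intro real_sqrt_le_mono divide_right_mono) auto
  also have "sqrt (16 * \<delta> / \<eta>) = 4 * (sqrt \<delta> / sqrt \<eta>)"
    using real_sqrt_mult[of 16 \<delta>] by (simp add: real_sqrt_divide)
  finally show ?thesis by simp
qed

lemma log2_le_smoothness_term:
  assumes "0 < X" "X \<le> 48 * M0 * q" "0 < \<eta>" "0 \<le> M0" "0 \<le> q"
  shows "log 2 (X / \<eta>) \<le> 16 * (M0 powr (2 / 7) * (q / \<eta>) powr (2 / 7))"
proof -
  have "log 2 (X / \<eta>) \<le> 21 / 4 * (X / \<eta>) powr (2 / 7)" using assms by (intro log2_le_powr) simp
  also have "(X / \<eta>) powr (2 / 7) \<le> (48 * (M0 * (q / \<eta>))) powr (2 / 7)"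
    using assms by (intro powr_mono2) (auto intro: divide_right_mono)
  also have "\<dots> = 48 powr (2 / 7) * (M0 powr (2 / 7) * (q / \<eta>) powr (2 / 7))"
    by (simp only: powr_mult)
  also have "\<dots> \<le> 64 / 21 * (M0 powr (2 / 7) * (q / \<eta>) powr (2 / 7))"
    using powr_le_of_power[of 48 "64/21" 2 7] by (intro mult_right_mono) (auto simp: power_divide)
  finally show ?thesis by simp
qed

context convex_hessian_smooth begin

text \<open>
  The reciprocal of \<open>r0\<close>, which is 0 for \<open>r0 = \<infinity>\<close>; this removes the case distinction from the
  bookkeeping.
\<close>

definition kappa :: real where "kappa = real_of_ereal (1 / r0)"

lemma kappa_nonneg: "0 \<le> kappa"
  unfolding kappa_def using r0_pos by (cases r0) (auto simp: one_ereal_def)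

lemma r0_finite: "r0 = ereal r \<Longrightarrow> kappa = 1 / r \<and> r > 0"
  unfolding kappa_def using r0_pos by (auto simp: one_ereal_def)

text \<open>
  Here \<open>\<Lambda>\<close> stands for the truncated logarithm in the last term of the gradient bound, in the
  case that it is finite; for \<open>r0 = \<infinity>\<close> the value 0 is admissible.
\<close>

definition log_ratio_bound :: "real \<Rightarrow> real \<Rightarrow> bool" where
  "log_ratio_bound gb \<Lambda> \<longleftrightarrow> 0 \<le> \<Lambda> \<and>
     (\<forall>r. r0 = ereal r \<longrightarrow> 0 < \<delta> + M0 * r \<and> log 2 ((\<delta> + gb / r) / (\<delta> + M0 * r)) \<le> \<Lambda>)"

text \<open>
  The number of doublings charged to the three causes. For a long trial step (\<open>r0 < q\<close>), the
  factor \<open>\<tau>/(\<delta> + M0 r0)\<close> is at most \<open>16/3 < 2\<^sup>5\<^sup>/\<^sup>2\<close> times \<open>2\<^sup>\<Lambda>\<close>, and the remaining factor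
  \<open>(\<delta> + M0 r0)/\<eta>\<close> is of one of the two other kinds.
\<close>

lemma trials_bound:
  assumes "\<eta> > 0" and ex: "tau_excess x (2 ^ j * \<eta>) q" and "0 \<le> q"
    and g: "norm (grad x) \<le> gb" and \<Lambda>: "log_ratio_bound gb \<Lambda>"
  shows "real j \<le> 12 * sqrt \<delta> * (1 / sqrt \<eta>) + 16 * (M0 powr (2 / 7) * (q / \<eta>) powr (2 / 7))
    + (if 1 < kappa * q then 5 / 2 + \<Lambda> else 0)"
proof -
  let ?\<tau> = "2 ^ j * \<eta>"
  let ?a = "12 * sqrt \<delta> * (1 / sqrt \<eta>)" and ?b = "16 * (M0 powr (2 / 7) * (q / \<eta>) powr (2 / 7))"
  have ab: "0 \<le> ?a" "0 \<le> ?b" using delta_nonneg assms by auto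
  have \<Lambda>0: "0 \<le> \<Lambda>" using \<Lambda> unfolding log_ratio_bound_def by simp
  have j: "real j = log 2 (?\<tau> / \<eta>)" using assms(1) by (simp add: log_nat_power)
  have \<tau>: "?\<tau> > 0" using assms(1) by simp
  have two: "log 2 (X / \<eta>) \<le> ?a + ?b" if "0 < X" "X \<le> 16 * \<delta> \<or> X \<le> 48 * M0 * q" for X
    using that(2)
  proof
    assume "X \<le> 16 * \<delta>"
    from log2_le_delta_term[OF that(1) this assms(1)] ab show ?thesis by linarith
  next
    assume "X \<le> 48 * M0 * q"
    from log2_le_smoothness_term[OF that(1) this assms(1) M0_nonneg assms(3)] ab show ?thesis by linarith
  qed
  consider "?\<tau> \<le> 16 * \<delta> \<or> ?\<tau> \<le> 48 * M0 * q"
    | r where "r0 = ereal r" "r < q" "?\<tau> \<le> 8 / 3 * (M0 * r + norm (grad x) / r)"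
    using ex unfolding tau_excess_def by blast
  then show ?thesis
  proof cases
    case 1
    then show ?thesis using two[OF \<tau>] j \<Lambda>0 by simp
  next
    case 2
    then have r: "r > 0" "kappa = 1 / r" using r0_finite by auto
    have "1 < 1 / r * q" using 2(2) r(1) by (simp add: field_simps)
    then have big: "1 < kappa * q" using r(2) by simp
    define a b where "a = \<delta> + M0 * r" and "b = \<delta> + gb / r"
    have a: "a > 0" and ba: "log 2 (b / a) \<le> \<Lambda>"
      using \<Lambda> 2(1) unfolding log_ratio_bound_def a_def b_def by auto
    have "0 \<le> gb" using g norm_ge_zero order_trans by blast
    then have b0: "0 \<le> b" unfolding b_def using delta_nonneg r by simp
    have "b \<le> a * 2 powr \<Lambda>"
    proof (cases "b = 0")
      case False
      then have "b / a \<le> 2 powr \<Lambda>" using ba a b0 by (simp add: log_le_iff)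
      then show ?thesis using a by (simp add: field_simps)
    qed (use a in simp)
    moreover have "a \<le> a * 2 powr \<Lambda>" using a \<Lambda>0 by (simp add: ge_one_powr_ge_zero)
    moreover have "norm (grad x) / r \<le> gb / r" using g r by (intro divide_right_mono) auto
    ultimately have "?\<tau> \<le> 16 / 3 * (a * 2 powr \<Lambda>)"
      using 2(3) delta_nonneg unfolding a_def b_def by argo
    then have "log 2 (?\<tau> / \<eta>) \<le> log 2 (16 / 3 * (2 powr \<Lambda> * (a / \<eta>)))"
      using \<tau> assms(1) a by (subst log_le_cancel_iff) (auto simp: field_simps)
    also have "\<dots> = log 2 (16 / 3) + (\<Lambda> + log 2 (a / \<eta>))"
    proof -
      have "log 2 (2 powr \<Lambda> * (a / \<eta>)) = \<Lambda> + log 2 (a / \<eta>)"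
        using a assms(1) by (subst log_mult) auto
      moreover have "log 2 (16 / 3 * (2 powr \<Lambda> * (a / \<eta>))) = log 2 (16 / 3) + log 2 (2 powr \<Lambda> * (a / \<eta>))"
        using a assms(1) by (subst log_mult) auto
      ultimately show ?thesis by simp
    qed
    also have "log 2 (16 / 3) \<le> 5 / 2"
    proof -
      have "log 2 ((16 / 3)\<^sup>2) \<le> log 2 (2 ^ 5)" by (subst log_le_cancel_iff) (auto simp: power2_eq_square)
      moreover have "log 2 ((16 / 3)\<^sup>2) = 2 * log 2 (16 / 3)" by (subst log_nat_power) auto
      moreover have "log 2 ((2::real) ^ 5) = 5" by (subst log_nat_power) auto
      ultimately show ?thesis by linarith
    qed
    also have "log 2 (a / \<eta>) \<le> ?a + ?b"
    proof (rule two[OF a])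
      have "M0 * r \<le> M0 * q" using 2(2) M0_nonneg by (intro mult_left_mono) auto
      moreover have "0 \<le> M0 * q" using M0_nonneg assms by simp
      ultimately show "a \<le> 16 * \<delta> \<or> a \<le> 48 * M0 * q" unfolding a_def using delta_nonneg by linarith
    qed
    finally show ?thesis using j big by simp
  qed
qed

end

text \<open>
  An undamped iteration grows \<open>\<surd>A\<close> by at least \<open>1/(2 \<surd>\<eta>)\<close>: this is what pays for the up-steps.
\<close>

lemma npe_a_growth:
  assumes "\<eta> > 0" "A > 0"
  shows "sqrt A + 1 / (2 * sqrt \<eta>) \<le> sqrt (A + npe_a \<eta> A)"
proof (rule real_le_rsqrt)
  have e: "sqrt A / sqrt \<eta> = sqrt (4 * \<eta> * A) / (2 * \<eta>)"
  proof -
    have "sqrt (4 * \<eta> * A) = 2 * sqrt \<eta> * sqrt A" by (simp add: real_sqrt_mult)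
    moreover have "\<eta> = sqrt \<eta> * sqrt \<eta>" using assms by simp
    ultimately show ?thesis using assms by (simp add: field_simps)
  qed
  have "(sqrt A + 1 / (2 * sqrt \<eta>))\<^sup>2 = A + sqrt A / sqrt \<eta> + 1 / (4 * \<eta>)"
    using assms by (simp add: power2_sum power_divide power_mult_distrib)
  also have "\<dots> \<le> A + (sqrt (1 + 4 * \<eta> * A) / (2 * \<eta>) + 1 / (2 * \<eta>))"
    unfolding e using assms by (simp add: divide_right_mono frac_le add_mono)
  also have "\<dots> = A + npe_a \<eta> A" unfolding npe_a_def by (simp add: add_divide_distrib)
  finally show "(sqrt A + 1 / (2 * sqrt \<eta>))\<^sup>2 \<le> A + npe_a \<eta> A" .
qed

section \<open>The cost of a run\<close>

locale npe_run = convex_hessian_smooth f H xs \<delta> M0 M1 \<rho>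
  for f :: "real^'d \<Rightarrow> real" and H xs \<delta> M0 M1 \<rho> +
  fixes x0 :: "real^'d" and \<eta>0 T gb :: real
  assumes eta0_pos: "\<eta>0 > 0" and target_pos: "T > 0"
    and gradient_bound: "norm (x - xs) \<le> (1 + 2 / sqrt 3) * norm (x0 - xs) \<Longrightarrow> norm (gradient f x) \<le> gb"
begin

abbreviation "R \<equiv> norm (x0 - xs)"
abbreviation "c0 \<equiv> critical_tau x0"

definition init_doublings :: real where "init_doublings = max 0 (log 2 (c0 / \<eta>0))"

text \<open>
  The parameter before the last doubling was below the threshold at \<open>x0\<close>.
\<close>

lemma first_call_trials:
  assumes "j = 0 \<or> ms_fails f H x0 (2 ^ j * \<eta>0 / 2)"
  shows "real j \<le> 1 + init_doublings" and "2 ^ j * \<eta>0 \<le> 2 * max \<eta>0 c0"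
proof -
  have "real j \<le> 1 + init_doublings \<and> 2 ^ j * \<eta>0 \<le> 2 * max \<eta>0 c0"
  proof (cases "j = 0")
    case True
    then show ?thesis using eta0_pos unfolding init_doublings_def by simp
  next
    case False
    then have c: "2 ^ j * \<eta>0 / 2 < c0"
      using assms eta0_pos by (intro ms_fails_below_critical) auto
    then have "2 ^ j < 2 * (c0 / \<eta>0)" using eta0_pos by (simp add: field_simps)
    moreover have "c0 > 0" using c eta0_pos by (smt (verit) divide_pos_pos mult_pos_pos zero_less_power)
    ultimately have "log 2 (2 ^ j) < log 2 (2 * (c0 / \<eta>0))"
      using eta0_pos by (subst log_less_cancel_iff) auto
    also have "\<dots> = 1 + log 2 (c0 / \<eta>0)"
      using eta0_pos \<open>c0 > 0\<close> by (subst log_mult) auto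
    finally have "real j < 1 + log 2 (c0 / \<eta>0)" by (simp add: log_nat_power)
    then show ?thesis using c unfolding init_doublings_def by (auto simp: max_def)
  qed
  then show "real j \<le> 1 + init_doublings" "2 ^ j * \<eta>0 \<le> 2 * max \<eta>0 c0" by auto
qed

text \<open>
  Of the five gradients per iteration two are the fixed cost of a call and \<open>5/2\<close> belong to a
  long trial step.
\<close>

definition gradient_budget :: "nat \<Rightarrow> real \<Rightarrow> real \<Rightarrow> real \<Rightarrow> real \<Rightarrow> real" where
  "gradient_budget k G \<Lambda> D Y = init_doublings + 5 * real k + G * \<Lambda> + 12 * sqrt \<delta> * D + 16 * (M0 powr (2 / 7) * Y)"

text \<open>
  The ledger is fed with \<open>2 S\<close>, because \<open>(15/14)\<^sup>2 \<le> 2\<close>: this covers the passage from accepted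
  displacements to the lengths \<open>q\<close>. The \<open>+ 2\<close> is the saving of the first call, which needs at
  most three gradients beyond \<open>init_doublings\<close>.
\<close>

lemma loop_invariant:
  assumes "npe_loop f H x0 \<eta>0 T k w z A \<eta> h n"
  shows "\<exists>S Q \<eta>1 D W Y G. tracked R S Q w z A \<and> ledger kappa T \<eta>1 (2 * S) D W Y G A \<eta> \<and>
    0 < \<eta>1 \<and> \<eta>1 \<le> 2 * max \<eta>0 c0 \<and> h = k \<and>
    (\<forall>\<Lambda>. log_ratio_bound gb \<Lambda> \<longrightarrow> real n + 2 \<le> gradient_budget k G \<Lambda> D Y)"
  using assms
proof induction
  case (init w \<eta> h n A z)
  note bt = ms_backtrack_accepted[OF init(1)]
  from bt(2) obtain j where j: "\<eta> = 2 ^ j * \<eta>0" "n \<le> j + 2" "j = 0 \<or> ms_fails f H x0 (\<eta> / 2)" by blast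
  have \<eta>: "\<eta> > 0" using j eta0_pos by simp
  have fc: "real j \<le> 1 + init_doublings" "\<eta> \<le> 2 * max \<eta>0 c0" using first_call_trials[of j] j by auto
  have "tracked R ((norm (w - x0))\<^sup>2) ((1 / \<eta>)\<^sup>2) w z A"
    unfolding init by (rule tracked_init[OF \<eta> bt(5)])
  moreover have "ledger kappa T \<eta> (2 * (norm (w - x0))\<^sup>2) 0 0 0 0 A \<eta>"
    unfolding init using \<eta> target_pos by (intro ledger_init) auto
  moreover have "real n + 2 \<le> gradient_budget 1 0 \<Lambda> 0 0" for \<Lambda>
    unfolding gradient_budget_def using fc j(2) by simp
  ultimately show ?case using \<eta> fc(2) bt(1) by blast
next
  case (step k w z A \<eta> h n y \<tau> h' n' a' A' \<gamma> a_next A_next w_next z_next \<eta>_next)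
  note bt = ms_backtrack_accepted[OF step(3)]
  from step.IH obtain S Q \<eta>1 D W Y G where t: "tracked R S Q w z A"
    and l: "ledger kappa T \<eta>1 (2 * S) D W Y G A \<eta>" and \<eta>1: "0 < \<eta>1" "\<eta>1 \<le> 2 * max \<eta>0 c0"
    and hk: "h = k" and n: "\<And>\<Lambda>. log_ratio_bound gb \<Lambda> \<Longrightarrow> real n + 2 \<le> gradient_budget k G \<Lambda> D Y" by blast
  let ?v = "npe_v \<eta> A w z"
  have \<eta>: "\<eta> > 0" and A: "A > 0" using l unfolding ledger_def by auto
  from bt(2) obtain j where j: "\<tau> = 2 ^ j * \<eta>" "n' \<le> j + 2" "j = 0 \<or> ms_fails f H ?v (\<tau> / 2)" by blast
  have \<tau>: "\<tau> > 0" "\<eta> \<le> \<tau>" using j \<eta> by (auto simp: mult_le_cancel_right)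
  have a': "a' > 0" unfolding step by (rule npe_a_quadratic[OF \<eta> A])
  let ?s = "(A + a') * \<eta> * (norm (y - ?v))\<^sup>2"
  have s0: "0 \<le> ?s" using A a' \<eta> by simp
  have t': "tracked R (S + ?s) (Q + (\<gamma> * a')\<^sup>2) w_next z_next A_next"
    by (rule tracked_step[OF t norm_ge_zero \<eta> \<tau>(2) refl \<open>a' = _\<close> \<open>\<gamma> = _\<close> bt(5)])
      (use step in auto)
  have g: "norm (grad ?v) \<le> gb" by (intro gradient_bound tracked_v[OF t norm_ge_zero \<eta>])
  show ?case
  proof (cases "j = 0")
    case True
    then have e: "\<tau> = \<eta>" "\<gamma> = 1" "A_next = A + a'" "\<eta>_next = \<eta> / 2" using j step \<eta> by auto
    have "ledger kappa T \<eta>1 (2 * (S + ?s)) D W Y G A_next \<eta>_next"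
      unfolding e(3,4) \<open>a' = _\<close> using s0 unfolding \<open>a' = _\<close>
      by (intro ledger_down[OF l]) (auto simp: npe_a_growth[OF \<eta> A])
    then have l': "ledger kappa T \<eta>1 (2 * (S + ?s)) D W Y G A_next \<eta>_next" .
    have count: "real (n + n') + 2 \<le> gradient_budget (Suc k) G \<Lambda> D Y" if "log_ratio_bound gb \<Lambda>" for \<Lambda>
      using n[OF that] j True unfolding gradient_budget_def by simp
    have "h + h' = Suc k" using hk bt(1) by simp
    then show ?thesis
      by (intro exI conjI allI impI) (rule t', rule l', rule \<eta>1(1), rule \<eta>1(2), assumption, erule count)
  next
    case False
    then have "(1::real) < 2 ^ j" by simp
    then have "\<tau> \<noteq> \<eta>" using j(1) \<eta> by simp
    then have e: "\<eta>_next = 2 * \<eta>" using step by simp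
    have AA: "A \<le> A_next" using step a' \<eta> \<tau> by simp
    let ?q = "15 / 14 * norm (y - ?v)"
    have ex: "tau_excess ?v (2 ^ j * \<eta>) ?q"
      using tau_excess_accepted[of \<tau> ?v] \<tau> j False bt(4) by auto
    have "A * \<eta> * ?q\<^sup>2 \<le> 2 * ?s"
    proof -
      have "A * \<eta> * ?q\<^sup>2 = 225 / 196 * (A * \<eta> * (norm (y - ?v))\<^sup>2)" by (simp add: power_mult_distrib power_divide)
      also have "\<dots> \<le> 2 * (A * \<eta> * (norm (y - ?v))\<^sup>2)" using A \<eta> by (intro mult_right_mono) auto
      also have "\<dots> \<le> 2 * ?s" using a' \<eta> by (intro mult_left_mono mult_right_mono) auto
      finally show ?thesis .
    qed
    then have "ledger kappa T \<eta>1 (2 * S + 2 * ?s) (D + 1 / sqrt \<eta>) (W + 1 / sqrt (A * \<eta>))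
        (Y + (?q / \<eta>) powr (2 / 7)) (G + (if 1 < kappa * ?q then 1 else 0)) A_next (2 * \<eta>)"
      by (intro ledger_up[OF l] step AA kappa_nonneg) auto
    then have l': "ledger kappa T \<eta>1 (2 * (S + ?s)) (D + 1 / sqrt \<eta>) (W + 1 / sqrt (A * \<eta>))
        (Y + (?q / \<eta>) powr (2 / 7)) (G + (if 1 < kappa * ?q then 1 else 0)) A_next \<eta>_next"
      unfolding e by (simp only: distrib_left)
    have "real (n + n') + 2 \<le> gradient_budget (Suc k) (G + (if 1 < kappa * ?q then 1 else 0)) \<Lambda>
        (D + 1 / sqrt \<eta>) (Y + (?q / \<eta>) powr (2 / 7))" if "log_ratio_bound gb \<Lambda>" for \<Lambda>
    proof -
      have "real j \<le> 12 * sqrt \<delta> * (1 / sqrt \<eta>) + 16 * (M0 powr (2 / 7) * (?q / \<eta>) powr (2 / 7))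
          + (if 1 < kappa * ?q then 5 / 2 + \<Lambda> else 0)"
        by (rule trials_bound[OF \<eta> ex _ g that]) simp
      then show ?thesis using n[OF that] j(2)
        unfolding gradient_budget_def distrib_left distrib_right of_nat_Suc of_nat_add by (simp split: if_splits)
    qed
    note count = this
    have "h + h' = Suc k" using hk bt(1) by simp
    then show ?thesis
      by (intro exI conjI allI impI) (rule t', rule l', rule \<eta>1(1), rule \<eta>1(2), assumption, erule count)
  qed
qed

end
lemma npe_a_ge:
  assumes "\<eta> > 0" "A \<ge> 0"
  shows "1 / \<eta> \<le> npe_a \<eta> A"
proof -
  have "1 \<le> sqrt (1 + 4 * \<eta> * A)" using assms by simp
  then have "2 / (2 * \<eta>) \<le> npe_a \<eta> A"
    unfolding npe_a_def using assms by (intro divide_right_mono) auto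
  then show ?thesis by simp
qed

context npe_run begin

text \<open>
  A bound for all parameters that a run can ever reach: the gradient is bounded on the ball
  that contains the query points.
\<close>

definition tau_cap :: real where
  "tau_cap = 2 * max (max \<eta>0 c0) (max (4 * \<delta>) (max (2 * sqrt ((M0 + M1 * gb) * gb)) (real_of_ereal (ereal (2 * gb) / \<rho>))))"

lemma critical_tau_le_cap:
  assumes g: "norm (grad x) \<le> gb"
  shows "2 * critical_tau x \<le> tau_cap"
proof -
  have "0 \<le> gb" using g norm_ge_zero order_trans by blast
  then have "L x * norm (grad x) \<le> (M0 + M1 * gb) * gb"
    unfolding local_lipschitz_const_def using g M0_nonneg M1_nonneg
    by (intro mult_mono add_left_mono mult_left_mono) auto
  then have "2 * sqrt (L x * norm (grad x)) \<le> 2 * sqrt ((M0 + M1 * gb) * gb)" by simp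
  moreover have "real_of_ereal (ereal (2 * norm (grad x)) / \<rho>) \<le> real_of_ereal (ereal (2 * gb) / \<rho>)"
    using radius_pos g by (cases \<rho>) (auto intro: divide_right_mono)
  ultimately have "critical_tau x \<le> max (4 * \<delta>) (max (2 * sqrt ((M0 + M1 * gb) * gb)) (real_of_ereal (ereal (2 * gb) / \<rho>)))"
    unfolding critical_tau_def by (intro max.mono order_refl)
  then show ?thesis unfolding tau_cap_def by simp
qed

text \<open>
  Every iteration adds \<open>\<gamma> a \<ge> \<gamma>/\<eta> = 1/\<tau>\<close> to \<open>A\<close>, and \<open>\<tau>\<close> is bounded.
\<close>

lemma loop_growth:
  assumes "npe_loop f H x0 \<eta>0 T k w z A \<eta> h n"
  shows "\<eta> \<le> tau_cap \<and> real k \<le> A * tau_cap"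
  using assms
proof induction
  case (init w \<eta> h n A z)
  from ms_backtrack_accepted(2)[OF init(1)]
  obtain j where j: "\<eta> = 2 ^ j * \<eta>0" "j = 0 \<or> ms_fails f H x0 (\<eta> / 2)" by blast
  have \<eta>: "\<eta> > 0" using j eta0_pos by simp
  have "\<eta> \<le> 2 * max \<eta>0 c0" using first_call_trials(2)[of j] j by auto
  also have "\<dots> \<le> tau_cap" unfolding tau_cap_def by simp
  finally show ?case using \<eta> init by simp
next
  case (step k w z A \<eta> h n y \<tau> h' n' a' A' \<gamma> a_next A_next w_next z_next \<eta>_next)
  from loop_invariant[OF step(1)] obtain S Q where t: "tracked R S Q w z A" and \<eta>: "\<eta> > 0" and A: "A > 0"
    unfolding ledger_def by blast
  let ?v = "npe_v \<eta> A w z"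
  have cap: "2 * critical_tau ?v \<le> tau_cap"
    by (intro critical_tau_le_cap gradient_bound tracked_v[OF t norm_ge_zero \<eta>])
  from ms_backtrack_accepted(2)[OF step(3)]
  obtain j where j: "\<tau> = 2 ^ j * \<eta>" "j = 0 \<or> ms_fails f H ?v (\<tau> / 2)" by blast
  have \<tau>: "\<tau> > 0" using j \<eta> by simp
  have \<tau>cap: "\<tau> \<le> tau_cap"
  proof (cases "j = 0")
    case False
    then have "\<tau> / 2 < critical_tau ?v" using j \<tau> by (intro ms_fails_below_critical) auto
    then show ?thesis using cap by simp
  qed (use j step.IH in simp)
  have "\<eta>_next \<le> tau_cap"
  proof (cases "j = 0")
    case True
    then show ?thesis using j step \<eta> \<tau>cap by simp
  next
    case False
    then obtain i where "j = Suc i" using not0_implies_Suc by blast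
    then have "\<tau> = 2 ^ i * (2 * \<eta>)" using j by simp
    moreover have "1 * (2 * \<eta>) \<le> 2 ^ i * (2 * \<eta>)" using \<eta> by (intro mult_right_mono) auto
    ultimately have "2 * \<eta> \<le> \<tau>" by simp
    then show ?thesis using step \<tau>cap \<eta> by (auto split: if_splits)
  qed
  moreover have "real (Suc k) \<le> A_next * tau_cap"
  proof -
    have "1 / tau_cap \<le> 1 / \<tau>" using \<tau>cap \<tau> by (intro divide_left_mono) auto
    also have "\<dots> = \<gamma> * (1 / \<eta>)" using step \<eta> by simp
    also have "\<dots> \<le> \<gamma> * a'"
      unfolding \<open>a' = _\<close> using npe_a_ge[of \<eta> A] \<eta> \<tau> A step by (intro mult_left_mono) auto
    also have "\<dots> = a_next" using step by simp
    finally have "1 \<le> a_next * tau_cap" using \<tau>cap \<tau> by (simp add: field_simps)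
    then show ?thesis using step by (simp add: distrib_right)
  qed
  ultimately show ?case by simp
qed

text \<open>
  Inner loops terminate at the threshold, and by \<open>loop_growth\<close> only finitely many outer
  iterations fit below the target.
\<close>

lemma npe_halts_exists: "\<exists>N h n. npe_halts f H x0 \<eta>0 T N h n"
proof (rule ccontr)
  assume none: "\<not> ?thesis"
  have run: "\<exists>w z A \<eta> h n. npe_loop f H x0 \<eta>0 T (Suc k) w z A \<eta> h n" for k
  proof (induction k)
    case 0
    obtain r h n where bt: "ms_backtrack f H x0 \<eta>0 r h n" using ms_backtrack_terminates[OF eta0_pos] by blast
    show ?case
    proof (cases r)
      case (Accepted w \<eta>)
      from npe_loop.init[OF bt[unfolded Accepted] refl refl, where T = T]
      show ?thesis unfolding One_nat_def by blast
    next
      case (ZeroGradient p)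
      then show ?thesis using none npe_halts.zero_return_init bt by blast
    qed
  next
    case (Suc k)
    then obtain w z A \<eta> h n where l: "npe_loop f H x0 \<eta>0 T (Suc k) w z A \<eta> h n" by blast
    have AT: "A < T" using none npe_halts.target_reached[OF l] by force
    have "\<eta> > 0" using loop_invariant[OF l] unfolding ledger_def by blast
    then obtain r h' n' where bt: "ms_backtrack f H (npe_v \<eta> A w z) \<eta> r h' n'"
      using ms_backtrack_terminates by blast
    show ?case
    proof (cases r)
      case (Accepted y \<tau>)
      from npe_loop.step[OF l AT bt[unfolded Accepted] refl refl refl refl refl refl refl refl]
      show ?thesis by blast
    next
      case (ZeroGradient p)
      then show ?thesis using none npe_halts.zero_return_step[OF l AT] bt by blast
    qed
  qed
  obtain k :: nat where k: "T * tau_cap < real k" using reals_Archimedean2 by blast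
  from run[of k] obtain w z A \<eta> h n where l: "npe_loop f H x0 \<eta>0 T (Suc k) w z A \<eta> h n" by blast
  have "0 < tau_cap" unfolding tau_cap_def using eta0_pos by (simp add: less_max_iff_disj)
  moreover have "T * tau_cap < A * tau_cap" using loop_growth[OF l] k by simp
  ultimately have "T \<le> A" by simp
  then show False using none npe_halts.target_reached[OF l] by blast
qed

text \<open>
  The number of iterations with a long trial step is at most five times this.
\<close>

definition long_step_factor :: real where
  "long_step_factor = max 1 ((kappa * R) powr (2 / 3)) * (1 + log_plus (8 * max \<eta>0 c0 * T)) powr (2 / 3)"

lemma long_step_factor_ge_one: "1 \<le> long_step_factor"
proof -
  have "1 \<le> (1 + log_plus (8 * max \<eta>0 c0 * T)) powr (2 / 3)"
    unfolding log_plus_def by (intro ge_one_powr_ge_zero) auto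
  then have "1 * 1 \<le> long_step_factor" unfolding long_step_factor_def by (intro mult_mono) auto
  then show ?thesis by simp
qed

lemma state_bounds:
  assumes t: "tracked R S Q w z A" and l: "ledger kappa T \<eta>1 (2 * S) D W Y G A \<eta>"
    and \<eta>1: "0 < \<eta>1" "\<eta>1 \<le> 2 * max \<eta>0 c0"
  shows "Y \<le> 27 / 5 * (R * T) powr (2 / 7)" and "G \<le> 5 * long_step_factor" and "D \<le> 7 / 2 * sqrt T"
proof -
  have V: "2 * S \<le> 8 / 3 * R\<^sup>2" using tracked_S[OF t] by simp
  show "Y \<le> 27 / 5 * (R * T) powr (2 / 7)"
    using ledger_Y_bound[OF l V] target_pos by simp
  have "G \<le> 5 * (kappa * R) powr (2 / 3) * (1 + log_plus (8 * max \<eta>0 c0 * T)) powr (2 / 3)"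
    by (rule ledger_G_bound[OF l V _ kappa_nonneg target_pos \<eta>1]) simp
  also have "\<dots> \<le> 5 * long_step_factor"
    unfolding long_step_factor_def by (auto intro!: mult_right_mono simp: mult.assoc)
  finally show "G \<le> 5 * long_step_factor" .
  show "D \<le> 7 / 2 * sqrt T" using l unfolding ledger_def by blast
qed

text \<open>
  A zero-gradient return adds one iteration to those accounted for in the invariant. Its
  length \<open>q\<close> is \<open>13/5 R\<close>, from \<open>6/5 (1 + 2/\<surd>3) \<le> 13/5\<close>, and \<open>1/\<eta> \<le> A < T\<close> by the matching, so
  it contributes a single term of the same form \<open>(R T)\<^sup>2\<^sup>/\<^sup>7\<close>.
\<close>

lemma npe_halts_cost:
  assumes "npe_halts f H x0 \<eta>0 T N h n"
  shows "h \<le> N" and "log_ratio_bound gb \<Lambda> \<Longrightarrow> real n \<le> 7 * real N + init_doublings + 42 * sqrt (\<delta> * T)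
      + 120 * (M0 * (R * T)) powr (2 / 7) + 8 * long_step_factor * \<Lambda>"
proof -
  let ?P = "(R * T) powr (2 / 7)"
  have init_doublings: "0 \<le> init_doublings" unfolding init_doublings_def by simp
  have P: "M0 powr (2 / 7) * ?P = (M0 * (R * T)) powr (2 / 7)"
    by (simp only: powr_mult)
  have sd: "12 * sqrt \<delta> * D \<le> 42 * sqrt (\<delta> * T)" if "D \<le> 7 / 2 * sqrt T" for D
    using mult_left_mono[OF that, of "12 * sqrt \<delta>"] delta_nonneg by (simp add: real_sqrt_mult)
  have sm: "16 * (M0 powr (2 / 7) * Y) \<le> 120 * (M0 * (R * T)) powr (2 / 7)" if "Y \<le> 15 / 2 * ?P" for Y
    using mult_left_mono[OF that, of "16 * M0 powr (2 / 7)"] unfolding P[symmetric] by simp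
  have "h \<le> N \<and> (log_ratio_bound gb \<Lambda> \<longrightarrow> real n \<le> 7 * real N + init_doublings + 42 * sqrt (\<delta> * T)
      + 120 * (M0 * (R * T)) powr (2 / 7) + 8 * long_step_factor * \<Lambda>)"
    using assms
  proof cases
    case (target_reached w z A \<eta>)
    from loop_invariant[OF target_reached(1)] obtain S Q \<eta>1 D W Y G where
      s: "tracked R S Q w z A" "ledger kappa T \<eta>1 (2 * S) D W Y G A \<eta>" "0 < \<eta>1" "\<eta>1 \<le> 2 * max \<eta>0 c0"
      and h: "h = N" and n: "\<And>\<Lambda>. log_ratio_bound gb \<Lambda> \<Longrightarrow> real n + 2 \<le> gradient_budget N G \<Lambda> D Y" by blast
    have "real n \<le> 7 * real N + init_doublings + 42 * sqrt (\<delta> * T)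
      + 120 * (M0 * (R * T)) powr (2 / 7) + 8 * long_step_factor * \<Lambda>" if \<Lambda>: "log_ratio_bound gb \<Lambda>"
    proof -
      have "0 \<le> \<Lambda>" using \<Lambda> unfolding log_ratio_bound_def by simp
      then have "G * \<Lambda> \<le> 8 * long_step_factor * \<Lambda>"
        using state_bounds(2)[OF s] long_step_factor_ge_one by (intro mult_right_mono) auto
      moreover have "16 * (M0 powr (2 / 7) * Y) \<le> 120 * (M0 * (R * T)) powr (2 / 7)"
        by (rule sm) (use state_bounds(1)[OF s] powr_ge_zero[of "R * T" "2 / 7"] in linarith)
      ultimately show ?thesis using n[OF \<Lambda>] sd[OF state_bounds(3)[OF s]]
        unfolding gradient_budget_def by linarith
    qed
    then show ?thesis using h by simp
  next
    case (zero_return_init p)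
    from ms_backtrack_zero[OF zero_return_init(2)] obtain j where
      j: "h = 1" "n \<le> j + 2" "j = 0 \<or> ms_fails f H x0 (2 ^ j * \<eta>0 / 2)" by blast
    have "real n \<le> 3 + init_doublings" using first_call_trials(1)[OF j(3)] j(2) by simp
    moreover have "0 \<le> 8 * long_step_factor * \<Lambda>" if "log_ratio_bound gb \<Lambda>"
      using that long_step_factor_ge_one unfolding log_ratio_bound_def by simp
    moreover have "0 \<le> sqrt (\<delta> * T)" using delta_nonneg target_pos by simp
    moreover have "0 \<le> (M0 * (R * T)) powr (2 / 7)" by simp
    ultimately show ?thesis using j(1) zero_return_init(1) by (smt (verit) of_nat_1 order_refl)
  next
    case (zero_return_step k w z A \<eta> h1 n1 p h' n')
    from loop_invariant[OF zero_return_step(4)] obtain S Q \<eta>1 D W Y G where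
      s: "tracked R S Q w z A" "ledger kappa T \<eta>1 (2 * S) D W Y G A \<eta>" "0 < \<eta>1" "\<eta>1 \<le> 2 * max \<eta>0 c0"
      and h: "h1 = k" and n: "\<And>\<Lambda>. log_ratio_bound gb \<Lambda> \<Longrightarrow> real n1 + 2 \<le> gradient_budget k G \<Lambda> D Y" by blast
    let ?v = "npe_v \<eta> A w z" and ?q = "13 / 5 * R"
    from ms_backtrack_zero[OF zero_return_step(6)] obtain j where
      j: "h' = 1" "n' \<le> j + 2" "j = 0 \<or> ms_fails f H ?v (2 ^ j * \<eta> / 2)" by blast
    have \<eta>: "\<eta> > 0" "A > 0" and match: "D + 7 / 2 / sqrt \<eta> \<le> 7 / 2 * sqrt A" "0 \<le> D"
      using s(2) unfolding ledger_def by auto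
    have AT: "sqrt A \<le> sqrt T" using zero_return_step(5) by simp
    have vd: "norm (?v - xs) \<le> (1 + 2 / sqrt 3) * R" by (rule tracked_v[OF s(1) norm_ge_zero \<eta>(1)])
    \<comment> \<open>A last call that doubles its parameter counts like one more up-step.\<close>
    have D': "D + 1 / sqrt \<eta> \<le> 7 / 2 * sqrt T"
    proof -
      have "0 \<le> 1 / sqrt \<eta>" "7 / 2 / sqrt \<eta> = 7 / 2 * (1 / sqrt \<eta>)" using \<eta> by auto
      then show ?thesis using match AT by linarith
    qed
    have Y': "Y + (?q / \<eta>) powr (2 / 7) \<le> 15 / 2 * ?P"
    proof -
      have "7 / 2 / sqrt \<eta> = 7 / 2 * (1 / sqrt \<eta>)" by simp
      then have "1 / sqrt \<eta> \<le> sqrt T" using match AT by linarith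
      then have "(1 / sqrt \<eta>)\<^sup>2 \<le> (sqrt T)\<^sup>2" using \<eta> by (intro power_mono) auto
      then have "1 / \<eta> \<le> T" using \<eta> target_pos by (simp add: power_divide)
      then have "?q * (1 / \<eta>) \<le> ?q * T" by (intro mult_left_mono) auto
      then have "(?q / \<eta>) powr (2 / 7) \<le> (13 / 5 * (R * T)) powr (2 / 7)"
        using \<eta> by (intro powr_mono2) auto
      also have "\<dots> = (13 / 5) powr (2 / 7) * ?P" by (rule powr_mult)
      also have "\<dots> \<le> 11 / 8 * ?P"
        using powr_le_of_power[of "13 / 5" "11 / 8" 2 7] by (intro mult_right_mono) (auto simp: power_divide)
      finally show ?thesis using state_bounds(1)[OF s] powr_ge_zero[of "R * T" "2 / 7"] by linarith
    qed
    have "real n \<le> 7 * real N + init_doublings + 42 * sqrt (\<delta> * T)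
      + 120 * (M0 * (R * T)) powr (2 / 7) + 8 * long_step_factor * \<Lambda>" if \<Lambda>: "log_ratio_bound gb \<Lambda>"
    proof -
      have \<Lambda>0: "0 \<le> \<Lambda>" using \<Lambda> unfolding log_ratio_bound_def by simp
      have jb: "real j \<le> 12 * sqrt \<delta> * (1 / sqrt \<eta>) + 16 * (M0 powr (2 / 7) * (?q / \<eta>) powr (2 / 7)) + (5 / 2 + \<Lambda>)"
      proof (cases "j = 0")
        case True
        have "0 \<le> 12 * sqrt \<delta> * (1 / sqrt \<eta>)" "0 \<le> 16 * (M0 powr (2 / 7) * (?q / \<eta>) powr (2 / 7))"
          using delta_nonneg \<eta> by auto
        then show ?thesis using True \<Lambda>0 by simp
      next
        case False
        have "sqrt 3 > 12 / 7" by (rule real_less_rsqrt) (simp add: power2_eq_square)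
        then have "2 / sqrt 3 \<le> 7 / 6" by (simp add: field_simps)
        then have "(1 + 2 / sqrt 3) * R \<le> 13 / 6 * R" by (intro mult_right_mono) auto
        then have "6 / 5 * norm (?v - xs) \<le> ?q" using vd by simp
        with False j have "tau_excess ?v (2 ^ j * \<eta>) ?q"
          using tau_excess_distance[of "2 ^ j * \<eta>" ?v] \<eta> tau_excess_mono by simp
        from trials_bound[OF \<eta>(1) this _ gradient_bound[OF vd] \<Lambda>] \<Lambda>0 show ?thesis
          by (simp split: if_splits)
      qed
      have "(G + 1) * \<Lambda> \<le> 8 * long_step_factor * \<Lambda>"
        using state_bounds(2)[OF s] long_step_factor_ge_one \<Lambda>0 by (intro mult_right_mono) auto
      then have "G * \<Lambda> + \<Lambda> \<le> 8 * long_step_factor * \<Lambda>" by (simp add: distrib_right)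
      moreover have "real n = real n1 + real n'" "real N = real k + 1" using zero_return_step by auto
      ultimately show ?thesis using n[OF \<Lambda>] sd[OF D'] sm[OF Y'] jb j(2)
        unfolding gradient_budget_def distrib_left by linarith
    qed
    then show ?thesis using h j(1) zero_return_step by simp
  qed
  then show "h \<le> N" and "log_ratio_bound gb \<Lambda> \<Longrightarrow> real n \<le> 7 * real N + init_doublings + 42 * sqrt (\<delta> * T)
      + 120 * (M0 * (R * T)) powr (2 / 7) + 8 * long_step_factor * \<Lambda>" by auto
qed

end

section \<open>The complexity bound\<close>

context convex_hessian_smooth begin

lemma kappa_powr_le:
  assumes "0 \<le> c"
  shows "(kappa * c) powr (2 / 3) \<le>
    max ((6 * sqrt M1 * c) powr (2 / 3)) (real_of_ereal (ereal (2 * c) / \<rho>) powr (2 / 3))"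
proof (cases r0)
  case (real r)
  then have r: "kappa = 1 / r" "r > 0" using r0_finite by auto
  consider "r0 = \<rho> / 2" | "r0 = 1 / ereal (6 * sqrt M1)" unfolding r0_def by (metis min_def)
  then show ?thesis
  proof cases
    case 1
    then have "\<rho> = ereal (2 * r)" using real by (cases \<rho>) auto
    then have "real_of_ereal (ereal (2 * c) / \<rho>) = kappa * c" using r by simp
    then show ?thesis by simp
  next
    case 2
    then have "M1 \<noteq> 0" using real by (auto simp: one_ereal_def)
    then have "r = 1 / (6 * sqrt M1)" using 2 real M1_nonneg by (simp add: one_ereal_def)
    then have "kappa = 6 * sqrt M1" using r by simp
    then show ?thesis by simp
  qed
qed (use r0_pos in \<open>auto simp: kappa_def le_max_iff_disj\<close>)

text \<open>
  If \<open>x0\<close> is stationary, the first queried gradient ends the run. This covers \<open>R = 0\<close>, where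
  the target is already 0.
\<close>

lemma stationary_start:
  assumes "grad x0 = 0" "npe_halts f H x0 \<eta>0 T N h n"
  shows "N = 1 \<and> h = 1 \<and> n = 1"
proof -
  have bt: "r = ZeroGradient x0 \<and> h = 1 \<and> n = 1" if "ms_backtrack f H x0 \<eta>0 r h n" for r h n
    using that assms(1) by cases auto
  have "False" if "npe_loop f H x0 \<eta>0 T k w z A \<eta> h n" for k w z A \<eta> h n
    using that by induction (auto dest: bt)
  with assms(2) bt show ?thesis by cases blast+
qed

end

lemma log2_plus_real:
  assumes "0 \<le> x"
  shows "log2_plus (ereal x) = ereal (max 0 (log 2 x))"
  using assms unfolding log2_plus_def by (cases "x = 0") (auto simp: log_def)

lemma log2_plus_nonneg: "0 \<le> log2_plus t"
  unfolding log2_plus_def by (simp add: le_max_iff_disj zero_ereal_def)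

theorem corollaryF6:
  fixes f :: "real^'d \<Rightarrow> real" and H :: "real^'d \<Rightarrow> real^'d^'d"
    and x0 xs :: "real^'d" and \<delta> M0 M1 \<eta>0 \<epsilon> R B \<tau>bar gbar :: real and \<rho> r0 :: ereal
  assumes "convex_on UNIV f"
    and "twice_continuously_differentiable f"
    and "\<forall>x. f xs \<le> f x"
    and "\<forall>x. transpose (H x) = H x"
    and "\<forall>x. op_norm (H x - hessian f x) \<le> \<delta>"
    and "M0 \<ge> 0" and "M1 \<ge> 0"
    and "(\<rho> = \<infinity> \<and> global_hessian_smooth f M0 M1) \<or>
         (\<exists>rad>0. \<rho> = ereal rad \<and> local_hessian_smooth f M0 M1 rad)"
    and "\<eta>0 > 0" and "\<epsilon> > 0"
    and "R = norm (x0 - xs)"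
    and "r0 = min (\<rho> / 2) (1 / ereal (6 * sqrt M1))"
    and "B = max 1 (max ((6 * sqrt M1 * R) powr (2/3))
                        (real_of_ereal (ereal (2 * R) / \<rho>) powr (2/3)))"
    and "\<tau>bar = max (4 * \<delta>)
           (max (2 * sqrt (local_lipschitz_const f M0 M1 x0 * norm (gradient f x0)))
                (real_of_ereal (ereal (2 * norm (gradient f x0)) / \<rho>)))"
    and "gbar = (SUP x \<in> {x. norm (x - xs) \<le> (1 + 2 / sqrt 3) * R}. norm (gradient f x))"
  shows "(\<exists>N h n. npe_halts f H x0 \<eta>0 (R^2 / (2 * \<epsilon>)) N h n) \<and>
    (\<forall>N h n. npe_halts f H x0 \<eta>0 (R^2 / (2 * \<epsilon>)) N h n \<longrightarrow>
       h \<le> N \<and>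
       ereal (real n) \<le>
         ereal (7 * real N)
         + log2_plus (ereal (\<tau>bar / \<eta>0))
         + ereal (30 * sqrt (2 * \<delta> * R^2 / \<epsilon>))
         + ereal (120 * (2 * M0 * R^3 / \<epsilon>) powr (2/7))
         + (if r0 = \<infinity> then 0
            else ereal (8 * B)
                 * log2_plus ((ereal \<delta> + ereal gbar / r0) / (ereal \<delta> + ereal M0 * r0))
                 * ereal ((1 + log_plus (4 * max \<eta>0 \<tau>bar * R^2 / \<epsilon>)) powr (2/3))))"
proof -
  let ?T = "R\<^sup>2 / (2 * \<epsilon>)" and ?g = "gradient f"
  let ?ratio = "(ereal \<delta> + ereal gbar / r0) / (ereal \<delta> + ereal M0 * r0)"
  let ?lp = "(1 + log_plus (4 * max \<eta>0 \<tau>bar * R^2 / \<epsilon>)) powr (2/3)"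
  let ?rhs = "\<lambda>N. ereal (7 * real N) + log2_plus (ereal (\<tau>bar / \<eta>0))
         + ereal (30 * sqrt (2 * \<delta> * R^2 / \<epsilon>)) + ereal (120 * (2 * M0 * R^3 / \<epsilon>) powr (2/7))
         + (if r0 = \<infinity> then 0 else ereal (8 * B) * log2_plus ?ratio * ereal ?lp)"
  interpret convex_hessian_smooth f H xs \<delta> M0 M1 \<rho>
  proof
    show "0 < \<rho>" using assms(8) by auto
    show "op_norm (hessian f y - hessian f x) \<le> local_lipschitz_const f M0 M1 x * norm (y - x)"
      if "ereal (norm (y - x)) \<le> \<rho>" for x y
      using assms(8) that unfolding global_hessian_smooth_def local_hessian_smooth_def by auto
  qed (use assms in auto)
  have r0: "r0 = convex_hessian_smooth.r0 M1 \<rho>" using assms(12) unfolding r0_def by simp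
  have \<tau>bar: "\<tau>bar = critical_tau x0" using assms(14) unfolding critical_tau_def by simp
  have \<tau>0: "0 \<le> \<tau>bar" using delta_nonneg unfolding assms(14) by (simp add: le_max_iff_disj)
  have R0: "0 \<le> R" unfolding assms(11) by simp
  have B1: "1 \<le> B" unfolding assms(13) by simp
  have last0: "0 \<le> (if r0 = \<infinity> then 0 else ereal (8 * B) * log2_plus ?ratio * ereal ?lp)"
    using B1 log2_plus_nonneg by simp
  have mid0: "0 \<le> 30 * sqrt (2 * \<delta> * R^2 / \<epsilon>)" "0 \<le> 120 * (2 * M0 * R^3 / \<epsilon>) powr (2/7)"
    using delta_nonneg assms(10) by auto
  show ?thesis
  proof (cases "?g x0 = 0")
    case True
    have ex: "npe_halts f H x0 \<eta>0 ?T 1 1 1"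
      by (rule npe_halts.zero_return_init[OF ms_backtrack.stationary[OF True]])
    have "ereal (real 1) \<le> ?rhs 1"
    proof -
      have "ereal 1 + 0 + 0 + 0 + 0 \<le> ?rhs 1"
        using last0 mid0 log2_plus_nonneg by (intro add_mono) auto
      then show ?thesis by simp
    qed
    then show ?thesis using ex stationary_start[OF True] by fastforce
  next
    case False
    then have "x0 \<noteq> xs" using gradient_at_minimizer by auto
    then have R: "R > 0" unfolding assms(11) by simp
    have T: "?T > 0" using R assms(10) by simp
    have gb: "norm (?g x) \<le> gbar" if "norm (x - xs) \<le> (1 + 2 / sqrt 3) * norm (x0 - xs)" for x
    proof -
      let ?S = "{x. norm (x - xs) \<le> (1 + 2 / sqrt 3) * R}"
      have S: "?S = cball xs ((1 + 2 / sqrt 3) * R)"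
        by (auto simp: dist_norm norm_minus_commute)
      have "compact ((\<lambda>x. norm (?g x)) ` ?S)"
        unfolding S by (intro compact_continuous_image continuous_intros gradient_continuous compact_cball)
      then have "bdd_above ((\<lambda>x. norm (?g x)) ` ?S)"
        by (intro bounded_imp_bdd_above compact_imp_bounded)
      then show ?thesis unfolding assms(15) using that assms(11) by (intro cSUP_upper) auto
    qed
    interpret run: npe_run f H xs \<delta> M0 M1 \<rho> x0 \<eta>0 ?T gbar
      by unfold_locales (use assms(9) T gb in auto)
    have gpos: "0 < gbar"
    proof -
      have "0 < norm (?g x0)" using False by simp
      also have "\<dots> \<le> gbar" by (rule gb) (simp add: distrib_right)
      finally show ?thesis .
    qed
    have init_doublings: "log2_plus (ereal (\<tau>bar / \<eta>0)) = ereal run.init_doublings"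
      unfolding run.init_doublings_def \<tau>bar[symmetric] using \<tau>0 assms(9) by (intro log2_plus_real) simp
    have lp: "8 * max \<eta>0 \<tau>bar * ?T = 4 * max \<eta>0 \<tau>bar * R^2 / \<epsilon>" using assms(10) by simp
    have "(kappa * R) powr (2 / 3) \<le> B"
      using kappa_powr_le[OF R0] unfolding assms(13) by (meson max.coboundedI2)
    then have rf: "run.long_step_factor \<le> B * ?lp"
      unfolding run.long_step_factor_def \<tau>bar[symmetric] lp assms(11)[symmetric] using B1
      by (intro mult_right_mono) auto
    have mid1: "42 * sqrt (\<delta> * ?T) \<le> 30 * sqrt (2 * \<delta> * R^2 / \<epsilon>)"
    proof -
      have "2 * \<delta> * R^2 / \<epsilon> = 2\<^sup>2 * (\<delta> * ?T)" using assms(10) by simp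
      then have "sqrt (2 * \<delta> * R^2 / \<epsilon>) = 2 * sqrt (\<delta> * ?T)"
        by (simp only: real_sqrt_mult[of "2\<^sup>2"] real_sqrt_abs)
      moreover have "0 \<le> sqrt (\<delta> * ?T)"
        by (rule real_sqrt_ge_zero[OF mult_nonneg_nonneg[OF delta_nonneg less_imp_le[OF T]]])
      ultimately show ?thesis by linarith
    qed
    have mid2: "120 * (M0 * (R * ?T)) powr (2 / 7) \<le> 120 * (2 * M0 * R^3 / \<epsilon>) powr (2/7)"
    proof (intro mult_left_mono powr_mono2)
      have "2 * M0 * R^3 / \<epsilon> = 4 * (M0 * (R * ?T))" by (simp add: power2_eq_square power3_eq_cube)
      moreover have "0 \<le> M0 * (R * ?T)" using M0_nonneg R assms(10) by simp
      ultimately show "M0 * (R * ?T) \<le> 2 * M0 * R^3 / \<epsilon>" by linarith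
    qed (use M0_nonneg R assms(10) in auto)
    have cost: "ereal (real n) \<le> ?rhs N" if halt: "npe_halts f H x0 \<eta>0 ?T N h n" for N h n
    proof -
      have bound: "ereal (real n) \<le> ?rhs N"
        if \<Lambda>: "log_ratio_bound gbar \<Lambda>" and last: "ereal (8 * (B * ?lp) * \<Lambda>) \<le>
          (if r0 = \<infinity> then 0 else ereal (8 * B) * log2_plus ?ratio * ereal ?lp)" for \<Lambda>
      proof -
        have "0 \<le> \<Lambda>" using \<Lambda> unfolding log_ratio_bound_def by simp
        then have "8 * run.long_step_factor * \<Lambda> \<le> 8 * (B * ?lp) * \<Lambda>"
          using rf by (intro mult_right_mono) auto
        then have "real n \<le> 7 * real N + run.init_doublings + 30 * sqrt (2 * \<delta> * R^2 / \<epsilon>)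
            + 120 * (2 * M0 * R^3 / \<epsilon>) powr (2/7) + 8 * (B * ?lp) * \<Lambda>"
          using run.npe_halts_cost(2)[OF halt \<Lambda>] mid1 mid2 unfolding assms(11)[symmetric] by linarith
        then have "ereal (real n) \<le> ereal (7 * real N) + ereal run.init_doublings + ereal (30 * sqrt (2 * \<delta> * R^2 / \<epsilon>))
            + ereal (120 * (2 * M0 * R^3 / \<epsilon>) powr (2/7)) + ereal (8 * (B * ?lp) * \<Lambda>)"
          by simp
        also have "\<dots> \<le> ?rhs N" unfolding init_doublings using last by (intro add_left_mono)
        finally show ?thesis .
      qed
      show ?thesis
      proof (cases r0)
        case (real r)
        have r: "r > 0" using real r0 r0_pos by simp
        show ?thesis
        proof (cases "\<delta> + M0 * r = 0")
          case True
          \<comment> \<open>The quotient in the last term is a positive number divided by 0, so the bound is infinite.\<close>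
          moreover have "0 < \<delta> + gbar / r" using delta_nonneg gpos r by (simp add: add_nonneg_pos)
          ultimately have "?ratio = \<infinity>" using real r by simp
          then have inf: "log2_plus ?ratio = \<infinity>" unfolding log2_plus_def by simp
          have "0 \<le> log_plus (4 * max \<eta>0 \<tau>bar * R^2 / \<epsilon>)" unfolding log_plus_def by simp
          then have "0 < ?lp" by simp
          then have last: "ereal (8 * B) * log2_plus ?ratio * ereal ?lp = \<infinity>"
            unfolding inf using B1 by simp
          have "r0 \<noteq> \<infinity>" using real by simp
          then have "?rhs N = ereal (7 * real N) + ereal run.init_doublings + ereal (30 * sqrt (2 * \<delta> * R^2 / \<epsilon>))
              + ereal (120 * (2 * M0 * R^3 / \<epsilon>) powr (2/7)) + \<infinity>"
            by (simp only: init_doublings last if_False)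
          also have "\<dots> = \<infinity>" by simp
          finally have rhs: "?rhs N = \<infinity>" .
          show ?thesis unfolding rhs by simp
        next
          case False
          then have pos: "0 < \<delta> + M0 * r" using delta_nonneg M0_nonneg r by (simp add: less_le)
          let ?x = "(\<delta> + gbar / r) / (\<delta> + M0 * r)"
          have "?ratio = ereal ?x" using real r pos by simp
          moreover have "0 \<le> ?x" using pos delta_nonneg gpos r by simp
          ultimately have log: "log2_plus ?ratio = ereal (max 0 (log 2 ?x))"
            using log2_plus_real by simp
          have fin: "ereal (8 * B) * ereal l * ereal c = ereal (8 * (B * c) * l)" for l c
            by (simp add: mult_ac)
          show ?thesis
          proof (rule bound)
            show "log_ratio_bound gbar (max 0 (log 2 ?x))"
              unfolding log_ratio_bound_def r0[symmetric] using real pos by simp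
            show "ereal (8 * (B * ?lp) * max 0 (log 2 ?x)) \<le>
              (if r0 = \<infinity> then 0 else ereal (8 * B) * log2_plus ?ratio * ereal ?lp)"
              unfolding log fin using real by simp
          qed
        qed
      next
        case PInf
        show ?thesis
          by (rule bound[of 0]) (use PInf r0 in \<open>auto simp: log_ratio_bound_def\<close>)
      next
        case MInf
        then show ?thesis using r0 r0_pos by simp
      qed
    qed
    show ?thesis using run.npe_halts_exists run.npe_halts_cost(1) cost by blast
  qed
qed

end
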